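(* Let $r\ge2$ and let $\mathbf C$ be a full subcategory of $\mathbf{OHgr}_{srq}(r)$ such that for every finite chain $\mathcal L$ there is an object in $\mathrm{Ob}(\mathbf C)$ isomorphic to $r\boxtimes\mathcal L$. Then $\mathbf C$ has the dual Ramsey property. In particular, the following categories have the dual Ramsey property: (1) the category $\mathbf{OHgr}_{srq}(r)$ for every $r\ge2$; (2) the category $\mathbf{OGra}_{srq}$; (3) the full subcategory of $\mathbf{OGra}_{srq}$ spanned by bipartite graphs; (4) for each fixed $n\ge3$, the full subcategory of $\mathbf{OGra}_{srq}$ spanned by $K_n$-free graphs.
   Context: Let $r\ge2$; $\binom Vk$ is the set of $k$-element subsets of $V$. A linearly ordered reflexive $r$-uniform hypergraph is $(V,E,\sqsubset)$ with $E=\binom V1\cup S$ for some $S\subseteq\binom Vr$ and $\sqsubset$ a (strict) linear order on $V$. A hypergraph homomorphism $f:(V,E)\to(V',E')$ is a map $f:V\to V'$ such that $e\in E$ implies $\{f(x):x\in e\}\in E'$; it induces $\tilde f:E\to E'$, $\tilde f(e)=\{f(x):x\in e\}$. Rigid surjection: a surjection $f$ between finite chains $(X,<)\to(Y,<')$ such that $\min f^{-1}(x)<\min f^{-1}(y)$ whenever $x<'y$. For a finite chain $(A,\sqsubset)$ and distinct $X,Y\subseteq A$ put $X\sqsubset_{alex}Y$ iff $X\subsetneq Y$, or $X,Y$ are incomparable under inclusion and $\max(X\setminus Y)\sqsubset\max(Y\setminus X)$. The linear order $\sqsubset_{sal}$ on $\mathcal P(A)$: $\varnothing$ is least; $\{x\}\sqsubset_{sal}\{y\}$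 iff $x\sqsubset y$; if $|X|=1$ and $|Y|>1$ then $X\sqsubset_{sal}Y$; if $|X|,|Y|>1$ then $X\sqsubset_{sal}Y$ iff $X\sqsubset_{alex}Y$. A strong rigid quotient map of hypergraphs from $(V,E,\sqsubset)$ to $(V',E',\sqsubset')$ is a hypergraph homomorphism $f:(V,E)\to(V',E')$ such that $\tilde f:(E,\sqsubset_{sal})\to(E',\sqsubset'_{sal})$ is a rigid surjection, and for every $e=\{x_1,\ldots,x_r\}\in E$, if $f|_e$ is not constant then $x_i\sqsubset x_j\Rightarrow f(x_i)\sqsubset'f(x_j)$ for all $i,j$. $\mathbf{OHgr}_{srq}(r)$ is the category of finite linearly ordered reflexive $r$-uniform hypergraphs and strong rigid quotient maps of hypergraphs; $\mathbf{OGra}_{srq}=\mathbf{OHgr}_{srq}(2)$, the category of finite linearly ordered reflexive graphs. Bipartiteness and $K_n$-freeness refer to the non-loop (2-element) edges. For a finite chain $\mathcal L=\{\ell_1\sqsubset\cdots\sqsubset\ell_N\}$, $r\boxtimes\mathcal L$ is the linearly ordered reflexive $r$-uniform hypergraph with vertex set $\{1,\ldots,r\}\times\{\ell_1,\ldots,\ell_N\}$, edge set consisting of all singletons and the sets $\{(1,\ell_j),(2,\ell_j),\ldots,(r,\ell_j)\}$, $1\le j\le N$, and linear order $(i,\ell)\prec(j,k)$ iff $\ell\sqsubset k$, or $\ell=k$ and $i<j$. A category $\mathbf C$ has the dual Ramsey property if for every integer $k\ge2$ and all objects $\mathcal A,\mathcal B$ with $\hom_{\mathbf C}(\mathcal B,\mathcal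 A)\neq\varnothing$ there is an object $\mathcal C$ such that for every coloring $\chi:\hom_{\mathbf C}(\mathcal C,\mathcal A)\to\{1,\ldots,k\}$ there is $w\in\hom_{\mathbf C}(\mathcal C,\mathcal B)$ such that $\chi$ is constant on $\{f\cdot w: f\in\hom_{\mathbf C}(\mathcal B,\mathcal A)\}$. *)

theory Defs
  imports Main "HOL-Library.FuncSet" "HOL-Library.Ramsey"
begin

subsection \<open>Categories and the dual Ramsey property\<close>

record ('o, 'm) cat =
  Ob :: "'o set"
  Hom :: "'o \<Rightarrow> 'o \<Rightarrow> 'm set"
  Id :: "'o \<Rightarrow> 'm"
  Comp :: "'o \<Rightarrow> 'o \<Rightarrow> 'o \<Rightarrow> 'm \<Rightarrow> 'm \<Rightarrow> 'm"

text \<open>\<open>Comp C A B D g f\<close> is the composite of \<open>f : A \<rightarrow> B\<close> followed by \<open>g : B \<rightarrow> D\<close>.\<close>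

definition category :: "('o, 'm) cat \<Rightarrow> bool" where
  "category C \<longleftrightarrow>
     (\<forall>A\<in>Ob C. Id C A \<in> Hom C A A) \<and>
     (\<forall>A\<in>Ob C. \<forall>B\<in>Ob C. \<forall>D\<in>Ob C. \<forall>f\<in>Hom C A B. \<forall>g\<in>Hom C B D.
        Comp C A B D g f \<in> Hom C A D) \<and>
     (\<forall>A\<in>Ob C. \<forall>B\<in>Ob C. \<forall>f\<in>Hom C A B.
        Comp C A A B f (Id C A) = f \<and> Comp C A B B (Id C B) f = f) \<and>
     (\<forall>A\<in>Ob C. \<forall>B\<in>Ob C. \<forall>D\<in>Ob C. \<forall>F\<in>Ob C.
        \<forall>f\<in>Hom C A B. \<forall>g\<in>Hom C B D. \<forall>h\<in>Hom C D F.
        Comp C A B F (Comp C B D F h g) f = Comp C A D F h (Comp C A B D g f))"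

definition full_subcat :: "('o, 'm) cat \<Rightarrow> 'o set \<Rightarrow> ('o, 'm) cat" where
  "full_subcat C Q = C\<lparr>Ob := Q\<rparr>"

definition dual_ramsey_property :: "('o, 'm) cat \<Rightarrow> bool" where
  "dual_ramsey_property C \<longleftrightarrow>
     (\<forall>k::nat. k \<ge> 2 \<longrightarrow> (\<forall>A\<in>Ob C. \<forall>B\<in>Ob C. Hom C B A \<noteq> {} \<longrightarrow>
        (\<exists>D\<in>Ob C. \<forall>\<chi> \<in> Hom C D A \<rightarrow> {1..k}.
           \<exists>w\<in>Hom C D B. \<exists>c. \<forall>f\<in>Hom C B A. \<chi> (Comp C D B A f w) = c)))"

subsection \<open>Finite chains and rigid surjections\<close>

text \<open>A chain is given by a carrier and a strict order relation, so that \<open>(x, y) \<in> lt\<close> reads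
  ``\<open>x\<close> is strictly below \<open>y\<close>''.\<close>

definition finite_chain :: "'a set \<Rightarrow> 'a rel \<Rightarrow> bool" where
  "finite_chain X lt \<longleftrightarrow> finite X \<and> lt \<subseteq> X \<times> X \<and> strict_linear_order_on X lt"

definition chain_min :: "'a rel \<Rightarrow> 'a set \<Rightarrow> 'a" where
  "chain_min lt S = (THE m. m \<in> S \<and> (\<forall>s\<in>S. s \<noteq> m \<longrightarrow> (m, s) \<in> lt))"

definition chain_max :: "'a rel \<Rightarrow> 'a set \<Rightarrow> 'a" where
  "chain_max lt S = (THE m. m \<in> S \<and> (\<forall>s\<in>S. s \<noteq> m \<longrightarrow> (s, m) \<in> lt))"

definition rigid_surjection ::
    "'a set \<Rightarrow> 'a rel \<Rightarrow> 'b set \<Rightarrow> 'b rel \<Rightarrow> ('a \<Rightarrow> 'b) \<Rightarrow> bool" where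
  "rigid_surjection X lt Y lt' f \<longleftrightarrow> f ` X = Y \<and>
     (\<forall>x\<in>Y. \<forall>y\<in>Y. (x, y) \<in> lt' \<longrightarrow>
        (chain_min lt {a\<in>X. f a = x}, chain_min lt {a\<in>X. f a = y}) \<in> lt)"

definition alex :: "'a set \<Rightarrow> 'a rel \<Rightarrow> 'a set rel" where
  "alex A lt = {(X, Y). X \<subseteq> A \<and> Y \<subseteq> A \<and>
     (X \<subset> Y \<or>
      \<not> X \<subseteq> Y \<and> \<not> Y \<subseteq> X \<and> (chain_max lt (X - Y), chain_max lt (Y - X)) \<in> lt)}"

definition sal :: "'a set \<Rightarrow> 'a rel \<Rightarrow> 'a set rel" where
  "sal A lt = {(X, Y). X \<subseteq> A \<and> Y \<subseteq> A \<and>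
     (X = {} \<and> Y \<noteq> {} \<or>
      (\<exists>x y. X = {x} \<and> Y = {y} \<and> (x, y) \<in> lt) \<or>
      card X = 1 \<and> card Y > 1 \<or>
      card X > 1 \<and> card Y > 1 \<and> (X, Y) \<in> alex A lt)}"

subsection \<open>Linearly ordered reflexive uniform hypergraphs\<close>

record 'a ohgr =
  verts :: "'a set"
  edges :: "'a set set"
  ord :: "'a rel"

definition fin_ordered_refl_hypergraph :: "nat \<Rightarrow> 'a ohgr \<Rightarrow> bool" where
  "fin_ordered_refl_hypergraph r H \<longleftrightarrow>
     finite_chain (verts H) (ord H) \<and>
     (\<exists>S \<subseteq> [verts H]\<^bsup>r\<^esup>. edges H = [verts H]\<^bsup>1\<^esup> \<union> S)"

definition hypergraph_hom :: "'a ohgr \<Rightarrow> 'b ohgr \<Rightarrow> ('a \<Rightarrow> 'b) \<Rightarrow> bool" where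
  "hypergraph_hom H H' f \<longleftrightarrow> f \<in> verts H \<rightarrow> verts H' \<and> (\<forall>e\<in>edges H. f ` e \<in> edges H')"

definition strong_rigid_quotient_map :: "'a ohgr \<Rightarrow> 'b ohgr \<Rightarrow> ('a \<Rightarrow> 'b) \<Rightarrow> bool" where
  "strong_rigid_quotient_map H H' f \<longleftrightarrow>
     hypergraph_hom H H' f \<and>
     rigid_surjection (edges H) (sal (verts H) (ord H)) (edges H') (sal (verts H') (ord H'))
       (\<lambda>e. f ` e) \<and>
     (\<forall>e\<in>edges H. \<not> (\<exists>c. \<forall>x\<in>e. f x = c) \<longrightarrow>
        (\<forall>x\<in>e. \<forall>y\<in>e. (x, y) \<in> ord H \<longrightarrow> (f x, f y) \<in> ord H'))"

text \<open>Extensionality makes the members of a hom-set correspond exactly to the maps from the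
  vertices of \<open>H\<close> to those of \<open>H'\<close>; otherwise colorings could tell apart total functions that
  agree on the vertices.\<close>

definition srq_homs :: "'a ohgr \<Rightarrow> 'b ohgr \<Rightarrow> ('a \<Rightarrow> 'b) set" where
  "srq_homs H H' = {f \<in> verts H \<rightarrow>\<^sub>E verts H'. strong_rigid_quotient_map H H' f}"

definition OHgr_srq :: "nat \<Rightarrow> ('a ohgr, 'a \<Rightarrow> 'a) cat" where
  "OHgr_srq r =
     \<lparr>Ob = {H. fin_ordered_refl_hypergraph r H},
      Hom = srq_homs,
      Id = (\<lambda>H. restrict id (verts H)),
      Comp = (\<lambda>H H' H'' g f. compose (verts H) g f)\<rparr>"

abbreviation OGra_srq :: "('a ohgr, 'a \<Rightarrow> 'a) cat" where
  "OGra_srq \<equiv> OHgr_srq 2"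

text \<open>Isomorphism through strong rigid quotient maps that are inverse to each other, also for
  hypergraphs whose vertices have different types.\<close>

definition isomorphic_srq :: "'a ohgr \<Rightarrow> 'b ohgr \<Rightarrow> bool" where
  "isomorphic_srq H K \<longleftrightarrow> (\<exists>f\<in>srq_homs H K. \<exists>g\<in>srq_homs K H.
     compose (verts H) g f = restrict id (verts H) \<and>
     compose (verts K) f g = restrict id (verts K))"

definition boxtimes :: "nat \<Rightarrow> 'l set \<Rightarrow> 'l rel \<Rightarrow> (nat \<times> 'l) ohgr" where
  "boxtimes r L lt =
     \<lparr>verts = {1..r} \<times> L,
      edges = [{1..r} \<times> L]\<^bsup>1\<^esup> \<union> (\<lambda>l. {1..r} \<times> {l}) ` L,
      ord = {((i, l), (j, k)). i \<in> {1..r} \<and> j \<in> {1..r} \<and> l \<in> L \<and> k \<in> L \<and>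
               ((l, k) \<in> lt \<or> l = k \<and> i < j)}\<rparr>"

definition bipartite :: "'a ohgr \<Rightarrow> bool" where
  "bipartite G \<longleftrightarrow> (\<exists>P Q. P \<union> Q = verts G \<and> P \<inter> Q = {} \<and>
     (\<forall>x y. {x, y} \<in> edges G \<and> x \<noteq> y \<longrightarrow> x \<in> P \<and> y \<in> Q \<or> x \<in> Q \<and> y \<in> P))"

definition clique_free :: "nat \<Rightarrow> 'a ohgr \<Rightarrow> bool" where
  "clique_free n G \<longleftrightarrow> \<not> (\<exists>K \<in> [verts G]\<^bsup>n\<^esup>. [K]\<^bsup>2\<^esup> \<subseteq> edges G)"

subsection \<open>The structures above form categories\<close>


lemma chain_subset: "finite_chain X lt \<Longrightarrow> Y \<subseteq> X \<Longrightarrow> trans lt \<and> irrefl lt \<and> total_on Y lt \<and> finite Y"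
  by (auto simp: finite_chain_def strict_linear_order_on_def total_on_def finite_subset)

lemma ex_min:
  assumes "finite S" "S \<noteq> {}" "trans lt" "total_on S lt"
  shows "\<exists>m\<in>S. \<forall>s\<in>S. s \<noteq> m \<longrightarrow> (m, s) \<in> lt"
  using assms
proof (induction S rule: finite_ne_induct)
  case (insert x F)
  then have "total_on F lt" by (auto simp: total_on_def)
  then obtain m where m: "m \<in> F" "\<forall>s\<in>F. s \<noteq> m \<longrightarrow> (m, s) \<in> lt" using insert by blast
  have "(x,m) \<in> lt \<or> (m,x) \<in> lt" using insert m by (auto simp: total_on_def)
  then show ?case using m \<open>trans lt\<close> by (metis insert_iff transD)
qed auto

lemma chain_minI:
  assumes "trans lt" "irrefl lt" "m \<in> S" "\<forall>s\<in>S. s \<noteq> m \<longrightarrow> (m, s) \<in> lt"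
  shows "chain_min lt S = m"
  unfolding chain_min_def using assms
  apply (intro the_equality) apply blast by (metis irrefl_def transD)

lemma chain_min:
  assumes "finite S" "S \<noteq> {}" "trans lt" "irrefl lt" "total_on S lt"
  shows "chain_min lt S \<in> S \<and> (\<forall>s\<in>S. s \<noteq> chain_min lt S \<longrightarrow> (chain_min lt S, s) \<in> lt)"
  using ex_min[OF assms(1,2,3,5)] chain_minI[OF assms(3,4)] by metis

lemma chain_max_conv: "chain_max lt S = chain_min (lt\<inverse>) S"
  by (simp add: chain_max_def chain_min_def)

lemma chain_max:
  assumes "finite S" "S \<noteq> {}" "trans lt" "irrefl lt" "total_on S lt"
  shows "chain_max lt S \<in> S \<and> (\<forall>s\<in>S. s \<noteq> chain_max lt S \<longrightarrow> (s, chain_max lt S) \<in> lt)"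
  using chain_min[of S "lt\<inverse>"] assms by (simp add: chain_max_conv irrefl_def total_on_converse)

lemma alex_iff:
  assumes c: "finite_chain A lt" and XY: "X \<subseteq> A" "Y \<subseteq> A"
  shows "(X, Y) \<in> alex A lt \<longleftrightarrow> (\<exists>m\<in>Y - X. \<forall>z\<in>A. (m, z) \<in> lt \<longrightarrow> (z \<in> X \<longleftrightarrow> z \<in> Y))"
proof -
  have t: "trans lt" "irrefl lt" "total_on A lt" "finite A"
    using c by (auto simp: finite_chain_def strict_linear_order_on_def)
  have as: "(y,x) \<notin> lt" if "(x,y) \<in> lt" for x y using t that by (meson irrefl_def transD)
  have mx: "chain_max lt (U - W) \<in> U - W \<and> (\<forall>s\<in>U-W. s \<noteq> chain_max lt (U-W) \<longrightarrow> (s, chain_max lt (U-W)) \<in> lt)"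
    if "U \<subseteq> A" "\<not> U \<subseteq> W" for U W
    using that t by (intro chain_max) (auto simp: total_on_def dest: finite_subset)
  show ?thesis
  proof
    assume "(X, Y) \<in> alex A lt"
    then consider "X \<subset> Y" | "\<not> X \<subseteq> Y" "\<not> Y \<subseteq> X" "(chain_max lt (X - Y), chain_max lt (Y - X)) \<in> lt"
      by (auto simp: alex_def)
    then show "\<exists>m\<in>Y - X. \<forall>z\<in>A. (m, z) \<in> lt \<longrightarrow> (z \<in> X \<longleftrightarrow> z \<in> Y)"
    proof cases
      case 1
      then have "\<not> Y \<subseteq> X" by auto
      note b = mx[OF XY(2) this]
      have "z \<in> X \<longleftrightarrow> z \<in> Y" if z: "(chain_max lt (Y - X), z) \<in> lt" for z
      proof -
        have "z \<noteq> chain_max lt (Y - X)" using as[OF z] z by metis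
        then have "z \<notin> Y - X" using b as[OF z] by blast
        then show ?thesis using 1 by blast
      qed
      then show ?thesis using b by blast
    next
      case 2
      let ?a = "chain_max lt (X - Y)" and ?b = "chain_max lt (Y - X)"
      have "z \<in> X \<longleftrightarrow> z \<in> Y" if z: "(?b, z) \<in> lt" for z
      proof (rule ccontr)
        assume "\<not> ?thesis"
        then consider "z \<in> Y - X" | "z \<in> X - Y" by blast
        then show False
        proof cases
          case 1
          then have "z = ?b \<or> (z, ?b) \<in> lt" using mx[OF XY(2) 2(2)] by blast
          then show False using as[OF z] z by auto
        next
          case 2
          then have "z = ?a \<or> (z, ?a) \<in> lt" using mx[OF XY(1) \<open>\<not> X \<subseteq> Y\<close>] by blast
          then have "(z, ?b) \<in> lt" using \<open>(?a, ?b) \<in> lt\<close> transD[OF t(1)] by blast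
          then show False using as[OF z] by blast
        qed
      qed
      then show ?thesis using mx[OF XY(2) 2(2)] by blast
    qed
  next
    assume "\<exists>m\<in>Y - X. \<forall>z\<in>A. (m, z) \<in> lt \<longrightarrow> (z \<in> X \<longleftrightarrow> z \<in> Y)"
    then obtain m where m: "m \<in> Y - X" "\<And>z. z\<in>A \<Longrightarrow> (m, z) \<in> lt \<Longrightarrow> (z \<in> X \<longleftrightarrow> z \<in> Y)" by blast
    show "(X, Y) \<in> alex A lt"
    proof (cases "X \<subseteq> Y")
      case True then show ?thesis using m XY by (auto simp: alex_def)
    next
      case False
      have n: "\<not> Y \<subseteq> X" using m by auto
      let ?a = "chain_max lt (X - Y)" and ?b = "chain_max lt (Y - X)"
      have a: "?a \<in> X - Y" and b: "?b \<in> Y - X" "m = ?b \<or> (m, ?b) \<in> lt"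
        using mx[OF XY(1) False] mx[OF XY(2) n] m by auto
      have "?b = m" using b m XY by blast
      moreover have "(?a, m) \<in> lt"
      proof -
        have *: "?a \<in> A" "m \<in> A" using a m XY by blast+
        have "?a \<noteq> m" using a m(1) by (metis DiffD1 DiffD2)
        moreover have "(m, ?a) \<notin> lt" using a m(2)[OF *(1)] by blast
        ultimately show ?thesis using t(3) * unfolding total_on_def by blast
      qed
      ultimately show ?thesis using False n XY by (auto simp: alex_def)
    qed
  qed
qed

lemma alex_trans:
  assumes c: "finite_chain A lt" and 1: "(X, Y) \<in> alex A lt" and 2: "(Y, Z) \<in> alex A lt"
  shows "(X, Z) \<in> alex A lt"
proof -
  have S: "X \<subseteq> A" "Y \<subseteq> A" "Z \<subseteq> A" using 1 2 by (auto simp: alex_def)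
  have t: "trans lt" "total_on A lt"
    using c by (auto simp: finite_chain_def strict_linear_order_on_def)
  obtain m where m: "m \<in> Y - X" "\<And>z. z\<in>A \<Longrightarrow> (m, z) \<in> lt \<Longrightarrow> (z \<in> X \<longleftrightarrow> z \<in> Y)"
    using 1 alex_iff[OF c S(1,2)] by blast
  obtain n where n: "n \<in> Z - Y" "\<And>z. z\<in>A \<Longrightarrow> (n, z) \<in> lt \<Longrightarrow> (z \<in> Y \<longleftrightarrow> z \<in> Z)"
    using 2 alex_iff[OF c S(2,3)] by blast
  have mA: "m \<in> A" "n \<in> A" "m \<noteq> n" using m n S by auto
  then consider "(m,n) \<in> lt" | "(n,m) \<in> lt" using t by (auto simp: total_on_def)
  then show ?thesis
  proof cases
    case 1
    then have "n \<in> Z - X" using m n mA by blast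
    moreover have "\<forall>z\<in>A. (n, z) \<in> lt \<longrightarrow> (z \<in> X \<longleftrightarrow> z \<in> Z)" using 1 m n t by (meson transD)
    ultimately show ?thesis using alex_iff[OF c S(1,3)] by blast
  next
    case 2
    then have "m \<in> Z - X" using m n mA by blast
    moreover have "\<forall>z\<in>A. (m, z) \<in> lt \<longrightarrow> (z \<in> X \<longleftrightarrow> z \<in> Z)" using 2 m n t by (meson transD)
    ultimately show ?thesis using alex_iff[OF c S(1,3)] by blast
  qed
qed

lemma alex_total:
  assumes c: "finite_chain A lt" and S: "X \<subseteq> A" "Y \<subseteq> A" "X \<noteq> Y"
  shows "(X, Y) \<in> alex A lt \<or> (Y, X) \<in> alex A lt"
proof -
  have t: "trans lt" "irrefl lt" "total_on A lt" "finite A"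
    using c by (auto simp: finite_chain_def strict_linear_order_on_def)
  show ?thesis
  proof (cases "X \<subseteq> Y \<or> Y \<subseteq> X")
    case True then show ?thesis using S by (auto simp: alex_def)
  next
    case False
    have "chain_max lt (X - Y) \<in> X - Y" "chain_max lt (Y - X) \<in> Y - X"
      using chain_max[of "X-Y" lt] chain_max[of "Y-X" lt] False t S
      by (auto simp: total_on_def finite_subset subset_iff)
    moreover from this have "chain_max lt (X - Y) \<noteq> chain_max lt (Y - X)" by (metis DiffD1 DiffD2)
    moreover from calculation S have "chain_max lt (X - Y) \<in> A" "chain_max lt (Y - X) \<in> A" by blast+
    ultimately show ?thesis using False S t(3) unfolding alex_def total_on_def by blast
  qed
qed

lemma sal_chain:
  assumes c: "finite_chain A lt"
  shows "finite_chain (Pow A) (sal A lt)"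
proof -
  have t: "trans lt" "irrefl lt" "total_on A lt" "finite A"
    using c by (auto simp: finite_chain_def strict_linear_order_on_def)
  have "trans (sal A lt)"
  proof (rule transI)
    fix X Y Z assume "(X,Y) \<in> sal A lt" "(Y,Z) \<in> sal A lt"
    then show "(X,Z) \<in> sal A lt"
      using alex_trans[OF c, of X Y Z]
      unfolding sal_def by (auto intro: transD[OF t(1)])
  qed
  moreover have "irrefl (sal A lt)"
    using t(2) by (auto simp: sal_def irrefl_def alex_def)
  moreover have "total_on (Pow A) (sal A lt)"
  proof (rule total_onI)
    fix X Y assume XY: "X \<in> Pow A" "Y \<in> Pow A" "X \<noteq> Y"
    have k: "Z = {} \<or> card Z = 1 \<or> card Z > 1" if "Z \<subseteq> A" for Z
      using that t(4) by (metis card_gt_0_iff finite_subset less_one nat_neq_iff)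
    show "(X, Y) \<in> sal A lt \<or> (Y, X) \<in> sal A lt"
    proof (cases "card X = 1 \<and> card Y = 1")
      case True
      then obtain x y where "X = {x}" "Y = {y}" by (auto simp: card_1_singleton_iff)
      then show ?thesis using XY t(3) by (auto simp: sal_def total_on_def)
    next
      case False
      then show ?thesis using k[of X] k[of Y] XY alex_total[OF c, of X Y] unfolding sal_def by auto
    qed
  qed
  ultimately show ?thesis using t(4) by (auto simp: finite_chain_def strict_linear_order_on_def sal_def)
qed

lemma rigid_compose:
  assumes f: "rigid_surjection X lx Y ly f" and g: "rigid_surjection Y ly Z lz g"
    and X: "finite X" "strict_linear_order_on X lx"
    and Y: "finite Y" "strict_linear_order_on Y ly"
  shows "rigid_surjection X lx Z lz (\<lambda>x. g (f x))"
proof -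
  have x: "trans lx" "irrefl lx" "total_on X lx" and y: "trans ly" "irrefl ly" "total_on Y ly"
    using X Y by (auto simp: strict_linear_order_on_def)
  have fX: "f ` X = Y" and gY: "g ` Y = Z" using f g by (auto simp: rigid_surjection_def)
  have mf: "chain_min lx {a\<in>X. f a = b} \<in> {a\<in>X. f a = b} \<and>
      (\<forall>s\<in>{a\<in>X. f a = b}. s \<noteq> chain_min lx {a\<in>X. f a = b} \<longrightarrow> (chain_min lx {a\<in>X. f a = b}, s) \<in> lx)"
    if "b \<in> Y" for b using that fX X x by (intro chain_min) (auto simp: total_on_def)
  have mg: "chain_min ly {a\<in>Y. g a = b} \<in> {a\<in>Y. g a = b} \<and>
      (\<forall>s\<in>{a\<in>Y. g a = b}. s \<noteq> chain_min ly {a\<in>Y. g a = b} \<longrightarrow> (chain_min ly {a\<in>Y. g a = b}, s) \<in> ly)"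
    if "b \<in> Z" for b using that gY Y y by (intro chain_min) (auto simp: total_on_def)
  have eq: "chain_min lx {a\<in>X. g (f a) = z} = chain_min lx {a\<in>X. f a = chain_min ly {b\<in>Y. g b = z}}"
    (is "_ = chain_min lx {a\<in>X. f a = ?b}") if z: "z \<in> Z" for z
  proof (rule chain_minI[OF x(1,2)])
    note B = mg[OF z]
    then have bY: "?b \<in> Y" by blast
    note M = mf[OF bY]
    show "chain_min lx {a\<in>X. f a = ?b} \<in> {a\<in>X. g (f a) = z}" using B M by simp
    show "\<forall>s\<in>{a\<in>X. g (f a) = z}. s \<noteq> chain_min lx {a\<in>X. f a = ?b} \<longrightarrow> (chain_min lx {a\<in>X. f a = ?b}, s) \<in> lx"
    proof (intro ballI impI)
      fix s assume s: "s \<in> {a\<in>X. g (f a) = z}" and ne: "s \<noteq> chain_min lx {a\<in>X. f a = ?b}"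
      have fsY: "f s \<in> Y" using s fX by auto
      show "(chain_min lx {a\<in>X. f a = ?b}, s) \<in> lx"
      proof (cases "f s = ?b")
        case True then show ?thesis using M s ne by blast
      next
        case False
        then have "(?b, f s) \<in> ly" using B s fsY by blast
        then have 1: "(chain_min lx {a\<in>X. f a = ?b}, chain_min lx {a\<in>X. f a = f s}) \<in> lx"
          using f bY fsY unfolding rigid_surjection_def by blast
        show ?thesis using mf[OF fsY] s 1 transD[OF x(1)] by (smt (verit, best) mem_Collect_eq)
      qed
    qed
  qed
  show ?thesis unfolding rigid_surjection_def
  proof (intro conjI ballI impI)
    show "(\<lambda>x. g (f x)) ` X = Z" using fX gY by auto
    fix u v assume uv: "u \<in> Z" "v \<in> Z" "(u,v) \<in> lz"
    then have "(chain_min ly {a\<in>Y. g a = u}, chain_min ly {a\<in>Y. g a = v}) \<in> ly"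
      using g by (auto simp: rigid_surjection_def)
    then show "(chain_min lx {a \<in> X. g (f a) = u}, chain_min lx {a \<in> X. g (f a) = v}) \<in> lx"
      using f mg[OF uv(1)] mg[OF uv(2)] unfolding eq[OF uv(1)] eq[OF uv(2)] rigid_surjection_def by blast
  qed
qed

lemma edges_chain:
  assumes "fin_ordered_refl_hypergraph r H"
  shows "finite (edges H)" "strict_linear_order_on (edges H) (sal (verts H) (ord H))"
    "edges H \<subseteq> Pow (verts H)"
proof -
  have c: "finite_chain (verts H) (ord H)" and s: "edges H \<subseteq> Pow (verts H)"
    using assms by (auto simp: fin_ordered_refl_hypergraph_def nsets_def)
  show "finite (edges H)" "strict_linear_order_on (edges H) (sal (verts H) (ord H))"
    using chain_subset[OF sal_chain[OF c] s] by (auto simp: strict_linear_order_on_def)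
  show "edges H \<subseteq> Pow (verts H)" by (rule s)
qed

lemma rigid_cong:
  assumes "rigid_surjection X lx Y ly f" "\<And>x. x \<in> X \<Longrightarrow> f x = g x"
  shows "rigid_surjection X lx Y ly g"
proof -
  have "{a\<in>X. f a = b} = {a\<in>X. g a = b}" for b using assms(2) by auto
  moreover have "f ` X = g ` X" using assms(2) by auto
  ultimately show ?thesis using assms(1) by (simp add: rigid_surjection_def)
qed

lemma srq_comp:
  assumes H: "fin_ordered_refl_hypergraph r A" "fin_ordered_refl_hypergraph r B"
    and f: "f \<in> srq_homs A B" and g: "g \<in> srq_homs B D"
  shows "compose (verts A) g f \<in> srq_homs A D"
proof -
  have fE: "f \<in> verts A \<rightarrow>\<^sub>E verts B" and gE: "g \<in> verts B \<rightarrow>\<^sub>E verts D" using f g by (auto simp: srq_homs_def)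
  note sA = edges_chain(3)[OF H(1)] and sB = edges_chain(3)[OF H(2)]
  have im: "compose (verts A) g f ` e = g ` f ` e" if "e \<in> edges A" for e
  proof -
    have "e \<subseteq> verts A" using that sA by auto
    then have "compose (verts A) g f ` e = (\<lambda>x. g (f x)) ` e"
      by (intro image_cong) (auto simp: compose_def)
    then show ?thesis by (simp add: image_image)
  qed
  have "rigid_surjection (edges A) (sal (verts A) (ord A)) (edges D) (sal (verts D) (ord D)) (\<lambda>e. g ` f ` e)"
    using rigid_compose[OF _ _ edges_chain(1,2)[OF H(1)] edges_chain(1,2)[OF H(2)]] f g
    by (auto simp: srq_homs_def strong_rigid_quotient_map_def)
  then have 1: "rigid_surjection (edges A) (sal (verts A) (ord A)) (edges D) (sal (verts D) (ord D)) (\<lambda>e. compose (verts A) g f ` e)"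
    by (rule rigid_cong) (simp add: im)
  have 2: "hypergraph_hom A D (compose (verts A) g f)"
    using f g fE gE im by (auto simp: srq_homs_def strong_rigid_quotient_map_def hypergraph_hom_def compose_def)
  have 3: "(compose (verts A) g f x, compose (verts A) g f y) \<in> ord D"
    if e: "e \<in> edges A" "\<not> (\<exists>c. \<forall>x\<in>e. compose (verts A) g f x = c)" "x \<in> e" "y \<in> e" "(x,y) \<in> ord A" for e x y
  proof -
    have V: "e \<subseteq> verts A" using e sA by auto
    have nf: "\<not> (\<exists>c. \<forall>x\<in>e. f x = c)" using e(2) V by (metis compose_eq subsetD)
    have a: "(f x, f y) \<in> ord B" using f e nf unfolding srq_homs_def strong_rigid_quotient_map_def by blast
    have fe: "f ` e \<in> edges B" using f e by (auto simp: srq_homs_def strong_rigid_quotient_map_def hypergraph_hom_def)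
    have ng: "\<not> (\<exists>c. \<forall>x\<in>f ` e. g x = c)" using e(2) V by (auto simp: compose_def subset_iff)
    have "(g (f x), g (f y)) \<in> ord D"
      using g fe ng a e unfolding srq_homs_def strong_rigid_quotient_map_def by blast
    then show ?thesis using V e by (auto simp: compose_def)
  qed
  have 4: "compose (verts A) g f \<in> verts A \<rightarrow>\<^sub>E verts D" using fE gE by (auto simp: compose_def)
  show ?thesis using 1 2 3 4 unfolding srq_homs_def strong_rigid_quotient_map_def by blast
qed

lemma rigid_id:
  assumes "strict_linear_order_on X lx" shows "rigid_surjection X lx X lx (\<lambda>x. x)"
proof -
  have "{a\<in>X. a = b} = {b}" if "b \<in> X" for b using that by auto
  moreover have "chain_min lx {b} = b" for b by (auto simp: chain_min_def)
  ultimately show ?thesis by (simp add: rigid_surjection_def)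
qed

lemma srq_id:
  assumes H: "fin_ordered_refl_hypergraph r A"
  shows "restrict id (verts A) \<in> srq_homs A A"
proof -
  note s = edges_chain[OF H]
  have im: "restrict id (verts A) ` e = e" if "e \<in> edges A" for e
  proof -
    have "e \<subseteq> verts A" using that s(3) by auto
    then show ?thesis by (force simp: image_iff subset_iff)
  qed
  have "rigid_surjection (edges A) (sal (verts A) (ord A)) (edges A) (sal (verts A) (ord A)) (\<lambda>e. restrict id (verts A) ` e)"
    by (rule rigid_cong[OF rigid_id[OF s(2)]]) (metis im)
  moreover have "hypergraph_hom A A (restrict id (verts A))"
    unfolding hypergraph_hom_def using im by (intro conjI ballI) (simp, metis)
  moreover have "(restrict id (verts A) x, restrict id (verts A) y) \<in> ord A"
    if "e \<in> edges A" "x \<in> e" "y \<in> e" "(x, y) \<in> ord A" for e x y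
    using that s(3) by auto
  moreover have "restrict id (verts A) \<in> verts A \<rightarrow>\<^sub>E verts A" by auto
  ultimately show ?thesis unfolding srq_homs_def strong_rigid_quotient_map_def
    by (intro CollectI conjI ballI impI)
qed

lemma boxtimes_Ob:
  assumes "finite_chain L lt"
  shows "boxtimes r L lt \<in> Ob (OHgr_srq r)"
proof -
  have "trans lt" "irrefl lt" "total_on L lt" "finite L" using assms by (auto simp: finite_chain_def strict_linear_order_on_def)
  then have "finite_chain (verts (boxtimes r L lt)) (ord (boxtimes r L lt))"
    unfolding finite_chain_def strict_linear_order_on_def boxtimes_def trans_def irrefl_def total_on_def
    by (auto; blast)
  moreover have "(\<lambda>l. {1..r} \<times> {l}) ` L \<subseteq> [{1..r} \<times> L]\<^bsup>r\<^esup>" by (auto simp: nsets_def card_cartesian_product)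
  ultimately show ?thesis by (auto simp: OHgr_srq_def fin_ordered_refl_hypergraph_def boxtimes_def)
qed

lemma category_OHgr_srq: "category (OHgr_srq r)"
proof -
  have simps [simp]: "Ob (OHgr_srq r) = {H. fin_ordered_refl_hypergraph r H}"
    "Hom (OHgr_srq r) = srq_homs" "Id (OHgr_srq r) = (\<lambda>H. restrict id (verts H))"
    "Comp (OHgr_srq r) = (\<lambda>H H' H'' g f. compose (verts H) g f)"
    by (simp_all add: OHgr_srq_def)
  have E: "f \<in> verts A \<rightarrow> verts B" "f \<in> extensional (verts A)"
    if "f \<in> srq_homs A B" for f :: "'a \<Rightarrow> 'a" and A B
    using that by (auto simp: srq_homs_def PiE_def)
  have r: "restrict id A = (\<lambda>x\<in>A. x)" for A :: "'a set"
    by (simp add: restrict_def fun_eq_iff)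
  show ?thesis
    unfolding category_def simps
  proof (intro conjI ballI; unfold mem_Collect_eq)
    show "restrict id (verts A) \<in> srq_homs A A" if "fin_ordered_refl_hypergraph r A" for A :: "'a ohgr"
      by (rule srq_id[OF that])
    show "compose (verts A) g f \<in> srq_homs A D"
      if "fin_ordered_refl_hypergraph r A" "fin_ordered_refl_hypergraph r B"
        "f \<in> srq_homs A B" "g \<in> srq_homs B D" for f g and A B D :: "'a ohgr"
      by (rule srq_comp[OF that])
    show "compose (verts A) f (restrict id (verts A)) = f" if "f \<in> srq_homs A B" for f and A B :: "'a ohgr"
      unfolding r by (rule compose_Id[OF E[OF that]])
    show "compose (verts A) (restrict id (verts B)) f = f" if "f \<in> srq_homs A B" for f and A B :: "'a ohgr"
      unfolding r by (rule Id_compose[OF E[OF that]])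
    show "compose (verts A) (compose (verts B) h g) f = compose (verts A) h (compose (verts A) g f)"
      if "f \<in> srq_homs A B" for f g h and A B :: "'a ohgr"
      by (rule compose_assoc[OF E(1)[OF that], symmetric])
  qed
qed

lemma category_full_subcat:
  assumes C: "category C" and Q: "\<And>A. A \<in> Q \<Longrightarrow> A \<in> Ob C"
  shows "category (full_subcat C Q)"
proof -
  have [simp]: "Ob (full_subcat C Q) = Q" "Hom (full_subcat C Q) = Hom C"
    "Id (full_subcat C Q) = Id C" "Comp (full_subcat C Q) = Comp C"
    by (simp_all add: full_subcat_def)
  show ?thesis
    unfolding category_def
    by (simp, intro conjI ballI; insert C Q; unfold category_def; meson)
qed

end

theory Submission
  imports Defs "HOL-Library.Nat_Bijection"
begin

text \<open>A rigid surjection from a chain onto the ordered edge set of a hypergraph \<open>A\<close> turns into a strong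
  rigid quotient map from \<open>r \<boxtimes> L\<close> onto \<open>A\<close>: the block over \<open>l\<close> is mapped monotonically onto the edge
  assigned to \<open>l\<close>. Composing such a map with a strong rigid quotient map \<open>f\<close> from \<open>B\<close> to \<open>A\<close>
  corresponds to composing the rigid surjection with the action of \<open>f\<close> on edges, which is rigid. Hence
  the dual Ramsey property follows from the finite dual Ramsey theorem for rigid surjections of chains.

  The latter is the Graham--Rothschild theorem over a one-letter alphabet. It is proved by induction
  on the number of parameters: the first parameter is turned into a new constant, and the
  Hales--Jewett theorem, obtained by Shelah's argument, takes care of the prefix before it.\<close>

subsection \<open>Parameter words\<close>

text \<open>Read as a map from positions to letters, a word in \<open>param_word 0 k\<close> is a
  rigid surjection onto \<open>{..<k}\<close>. For k > 0 its first letter is 0; without that letter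
  it has k - 1 parameters over the alphabet {0}, which explains the one-letter alphabet. The
  obstacle lies in the parameter induction. Even among words of one fixed length, the prefixes
  before the first parameter have different lengths, so \<open>graham_rothschild a 0\<close> must
  make constant words of different lengths agree under one and the same \<open>w\<close>. Hence
  substitution truncates, all lengths are coloured together, and the base case over one letter
  becomes a pigeonhole for lengths; padding with zeros restores a fixed length at the end. On the
  hypergraph side, \<open>sal\<close> places all loops before all other edges, which makes the map
  from the box rigid even on single vertices. A strong rigid quotient map is constant or increasing
  on each edge, which makes the passage from words to maps compatible with composition.\<close>

fun param_word :: "nat \<Rightarrow> nat \<Rightarrow> nat list \<Rightarrow> bool" where
  "param_word a k [] \<longleftrightarrow> k = 0"
| "param_word a k (x # xs) \<longleftrightarrow> x < a \<and> param_word a k xs \<or> x = a \<and> k > 0 \<and> param_word (Suc a) (k - 1) xs"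

text \<open>A word in \<open>param_word a k\<close> has constants \<open>{..<a}\<close> and parameters \<open>a, \<dots>, a + k - 1\<close>, whose first
  occurrences appear in this order. In \<open>param_subst s g w\<close> the letters below \<open>length s\<close> are looked up
  in \<open>s\<close>, and each new parameter takes the next letter of \<open>g\<close>; when \<open>g\<close> is exhausted the word is
  truncated at the first occurrence of the next parameter, so that a single \<open>w\<close> acts on words of
  every length up to the number of its parameters.\<close>

fun param_subst :: "nat list \<Rightarrow> nat list \<Rightarrow> nat list \<Rightarrow> nat list" where
  "param_subst s g [] = []"
| "param_subst s g (x # w) =
    (if x < length s then s ! x # param_subst s g w
     else case g of [] \<Rightarrow> [] | y # g' \<Rightarrow> y # param_subst (s @ [y]) g' w)"

text \<open>Frees the letter \<open>a\<close>: the renamed word can be read over an alphabet in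
  which \<open>a\<close> is a new constant that it does not use.\<close>

definition skip :: "nat \<Rightarrow> nat \<Rightarrow> nat" where
  "skip a x = (if x < a then x else Suc x)"

lemma param_word_0_iff: "param_word a 0 w \<longleftrightarrow> set w \<subseteq> {..<a}"
  by (induction w) auto

lemma param_word_const_append: "set v \<subseteq> {..<a} \<Longrightarrow> param_word a k (v @ w) \<longleftrightarrow> param_word a k w"
  by (induction v) auto

lemma param_word_append_const: "param_word a k w \<Longrightarrow> set v \<subseteq> {..<a} \<Longrightarrow> param_word a k (w @ v)"
  by (induction a k w rule: param_word.induct) (auto simp: param_word_0_iff subset_iff less_Suc_eq)

lemma param_word_upt: "param_word a k [a..<a + k]"
proof (induction k arbitrary: a)
  case (Suc k)
  then show ?case using Suc[of "Suc a"] by (simp add: upt_conv_Cons del: upt_Suc)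
qed simp

lemma param_word_SucE:
  assumes "param_word a (Suc k) g"
  obtains v u where "g = v @ a # u" "set v \<subseteq> {..<a}" "param_word (Suc a) k u"
proof -
  have "\<exists>v u. g = v @ a # u \<and> set v \<subseteq> {..<a} \<and> param_word (Suc a) k u"
    using assms
  proof (induction g)
    case (Cons x g)
    then consider "x < a" "param_word a (Suc k) g" | "x = a" "param_word (Suc a) k g" by auto
    then show ?case
    proof cases
      case 1
      then obtain v u where "g = v @ a # u \<and> set v \<subseteq> {..<a} \<and> param_word (Suc a) k u"
        using Cons.IH by blast
      then show ?thesis using 1 by (intro exI[of _ "x # v"] exI[of _ u]) auto
    next
      case 2 then show ?thesis by (intro exI[of _ "[]"] exI[of _ g]) auto
    qed
  qed simp
  then show thesis using that by blast
qed

lemma param_word_skip: "param_word b k w \<Longrightarrow> a \<le> b \<Longrightarrow> param_word (Suc b) k (map (skip a) w)"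
  by (induction b k w rule: param_word.induct) (auto simp: skip_def)

section \<open>Substitution as composition of parameter words\<close>

lemma length_subst: "length (param_subst s g w) \<le> length w"
  by (induction s g w rule: param_subst.induct) (auto split: list.split)

lemma set_subst: "set (param_subst s g w) \<subseteq> set s \<union> set g"
proof (induction s g w rule: param_subst.induct)
  case (2 s g x w)
  show ?case
  proof (cases "x < length s")
    case True then show ?thesis using 2(1) by auto
  next
    case False
    show ?thesis
    proof (cases g)
      case (Cons y g')
      then show ?thesis using 2(2)[OF False Cons] False by auto
    qed (use False in simp)
  qed
qed simp

lemma map_subst: "map f (param_subst s g w) = param_subst (map f s) (map f g) w"
  by (induction s g w rule: param_subst.induct) (auto split: list.split)

lemma subst_const_append:
  "set v \<subseteq> {..<length s} \<Longrightarrow> param_subst s g (v @ w) = map ((!) s) v @ param_subst s g w"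
  by (induction v) auto

text \<open>The renamed word never looks up the inserted \<open>y\<close>. The list \<open>t\<close>
  collects the letters that the recursion appends to the lookup list behind it.\<close>

lemma subst_skip:
  "param_subst (s @ y # t) g (map (skip (length s)) w) = param_subst (s @ t) g w"
proof (induction w arbitrary: t g)
  case (Cons x w)
  consider "x < length s" | "length s \<le> x" "x < length s + length t" | "length s + length t \<le> x"
    by linarith
  then show ?case
  proof cases
    case 1
    then show ?thesis using Cons[of t g] by (simp add: skip_def nth_append)
  next
    case 2
    then show ?thesis using Cons[of t g] by (simp add: skip_def nth_append Suc_diff_le)
  next
    case 3
    then show ?thesis using Cons[of "t @ [_]" "tl g"] by (cases g) (simp_all add: skip_def)
  qed
qed simp

lemma subst_skip_upt:
  "param_subst ([0..<a] @ [y]) g (map (skip a) w) = param_subst [0..<a] g w"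
  using subst_skip[of "[0..<a]" y "[]" g w] by simp

text \<open>Because \<open>w\<close> introduces \<open>m \<ge> length g\<close> parameters,
  \<open>g\<close> is read to its end and none of its parameters is lost. In between,
  \<open>w\<close> only repeats letters already read or given in \<open>s\<close>, so first
  occurrences keep their order.\<close>

lemma param_word_subst:
  "param_word b m w \<Longrightarrow> param_word a k g \<Longrightarrow> length s = b \<Longrightarrow> set s \<subseteq> {..<a} \<Longrightarrow> length g \<le> m
    \<Longrightarrow> param_word a k (param_subst s g w)"
proof (induction b m w arbitrary: a k g s rule: param_word.induct)
  case (2 b m x w)
  show ?case
  proof (cases "x < b")
    case True
    then have "s ! x < a" using 2 by (meson lessThan_iff nth_mem subsetD)
    then show ?thesis using 2 True by auto
  next
    case False
    then have x: "x = b" "m > 0" "param_word (Suc b) (m - 1) w" using 2 by auto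
    show ?thesis
    proof (cases g)
      case Nil then show ?thesis using 2 x by auto
    next
      case (Cons y g')
      then consider "y < a" "param_word a k g'" | "y = a" "k > 0" "param_word (Suc a) (k - 1) g'" using 2 by auto
      then show ?thesis
      proof cases
        case 1
        then show ?thesis using 2 x Cons by auto
      next
        case c: 2
        have "param_word (Suc a) (k - 1) (param_subst (s @ [y]) g' w)"
          by (rule "2.IH"(2)[OF x(3) c(3)]) (use "2.prems" x Cons c in auto)
        then show ?thesis using 2 x Cons c by auto
      qed
    qed
  qed
qed auto

text \<open>Associativity of substitution. Truncation respects it: the parameter of \<open>v\<close>
  at which \<open>g\<close> runs out cuts off the inner substitution on the right, and
  \<open>w\<close> stops there when it asks for the next letter.\<close>

lemma subst_subst:
  "param_word (length s) m v \<Longrightarrow> set t \<subseteq> {..<length s} \<Longrightarrow>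
    param_subst s g (param_subst t v w) = param_subst (map ((!) s) t) (param_subst s g v) w"
proof (induction w arbitrary: s t g v m)
  case (Cons x w)
  show ?case
  proof (cases "x < length t")
    case True
    then have "t ! x < length s" using Cons.prems(2) by (meson lessThan_iff nth_mem subsetD)
    then show ?thesis using Cons True by auto
  next
    case x: False
    show ?thesis
    proof (cases v)
      case v: (Cons y v')
      show ?thesis
      proof (cases "y < length s")
        case True
        then have "param_word (length s) m v'" using Cons.prems v by auto
        then show ?thesis using Cons.IH[of s m v' "t @ [y]" g] Cons.prems v x True by auto
      next
        case False
        then have y: "y = length s" "param_word (Suc (length s)) (m - 1) v'" using Cons.prems v by auto
        show ?thesis
        proof (cases g)
          case Nil then show ?thesis using v x y by auto
        next
          case g: (Cons z g')
          have "map ((!) (s @ [z])) t = map ((!) s) t"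
            using Cons.prems(2) by (auto simp: nth_append)
          then have map: "map ((!) (s @ [z])) (t @ [y]) = map ((!) s) t @ [z]"
            using y(1) by simp
          show ?thesis
            using map Cons.IH[of "s @ [z]" "m - 1" v' "t @ [y]" g'] Cons.prems v x y g
            by (simp add: subset_iff less_Suc_eq del: map_append map_eq_conv)
        qed
      qed
    qed (use x in auto)
  qed
qed simp

lemma subst_subst_upt:
  assumes "param_word a m v"
  shows "param_subst [0..<a] g (param_subst [0..<a] v w) = param_subst [0..<a] (param_subst [0..<a] g v) w"
  using subst_subst[of "[0..<a]" m v "[0..<a]" g w] assms
  by (simp add: map_nth[of "[0..<a]", simplified] atLeast0LessThan)

text \<open>With \<open>length v < m\<close> the word \<open>w\<close> still has a parameter when
  \<open>v\<close> is used up. Substituting \<open>v\<close> alone cuts \<open>w\<close> at the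
  first occurrence of that parameter, which is exactly where \<open>y\<close> goes.\<close>

lemma subst_append:
  "param_word (length s) m w \<Longrightarrow> length v < m \<Longrightarrow> \<exists>z. param_subst s (v @ y # u) w = param_subst s v w @ y # z"
proof (induction w arbitrary: s m v)
  case (Cons x w)
  show ?case
  proof (cases "x < length s")
    case True then show ?thesis using Cons by auto
  next
    case False
    then have "param_word (Suc (length s)) (m - 1) w" using Cons.prems by auto
    then show ?thesis using False Cons.IH[of "s @ [_]" "m - 1" "tl v"] Cons.prems
      by (cases v) auto
  qed
qed simp

text \<open>If \<open>g\<close> has one letter for each parameter, nothing is truncated and
  substitution is composition of maps; this is the link to rigid surjections.\<close>

lemma subst_eq_map: "param_word (length s) m w \<Longrightarrow> length g = m \<Longrightarrow> param_subst s g w = map ((!) (s @ g)) w"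
proof (induction w arbitrary: s m g)
  case (Cons x w)
  show ?case
  proof (cases "x < length s")
    case True then show ?thesis using Cons by (auto simp: nth_append)
  next
    case False
    then have x: "x = length s" "param_word (Suc (length s)) (m - 1) w" "m > 0" using Cons.prems by auto
    then obtain y g' where "g = y # g'" using Cons.prems by (cases g) auto
    then show ?thesis using x Cons.IH[of "s @ [y]" "m - 1" g'] Cons.prems by auto
  qed
qed simp

subsection \<open>The Graham--Rothschild theorem\<close>

text \<open>Encodes tuples of colours as single colours, so that an induction hypothesis about
  numbers below a bound applies to colourings by tuples.\<close>

lemma recolor:
  assumes "finite S"
  obtains e :: "'c \<Rightarrow> nat" where "inj_on e S" "\<And>x. x \<in> S \<Longrightarrow> e x < card S"
  using ex_bij_betw_finite_nat[OF assms] by (metis bij_betw_def imageI atLeastLessThan_iff)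

lemma finite_vectors: "finite {xs. set xs \<subseteq> {..<R::nat} \<and> length xs = l}"
  by (rule finite_lists_length_eq) simp

text \<open>The Graham--Rothschild statement, in a form that colours words of all lengths at once; the
  parameter induction below needs this strength.\<close>

definition graham_rothschild :: "nat \<Rightarrow> nat \<Rightarrow> bool" where
  "graham_rothschild a k \<longleftrightarrow> (\<forall>R m. \<exists>n. \<forall>\<chi> :: nat list \<Rightarrow> nat. (\<forall>g. \<chi> g < R) \<longrightarrow>
     (\<exists>w. param_word a m w \<and> length w \<le> n \<and>
       (\<forall>g h. param_word a k g \<longrightarrow> param_word a k h \<longrightarrow> length g \<le> m \<longrightarrow> length h \<le> m \<longrightarrow>
          \<chi> (param_subst [0..<a] g w) = \<chi> (param_subst [0..<a] h w))))"

section \<open>The Hales--Jewett theorem for words of varying length\<close>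

text \<open>Shelah's pigeonhole argument: each block of the word is a line through two words of the form
  \<open>(b + 1)\<^sup>i b\<^sup>N\<^sup>-\<^sup>i\<close> that no continuation can distinguish.\<close>

lemma insensitive_subst:
  fixes b :: nat
  defines "a \<equiv> Suc (Suc b)" and "c \<equiv> (\<lambda>x. if x = Suc b then b else x)"
  shows "\<exists>n. \<forall>\<chi> :: nat list \<Rightarrow> nat. (\<forall>g. \<chi> g < R) \<longrightarrow>
     (\<exists>w. param_word a m w \<and> length w \<le> n \<and>
       (\<forall>g. set g \<subseteq> {..<a} \<longrightarrow> length g \<le> m \<longrightarrow>
          \<chi> (param_subst [0..<a] g w) = \<chi> (param_subst [0..<a] (map c g) w)))"
proof (induction m arbitrary: R)
  case 0
  show ?case by (intro exI[of _ 0] allI impI exI[of _ "[]"]) simp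
next
  case (Suc m)
  define S where "S = {xs. set xs \<subseteq> {..<R} \<and> length xs = a}"
  have fS: "finite S" unfolding S_def by (rule finite_vectors)
  obtain e :: "nat list \<Rightarrow> nat" where e: "inj_on e S" "\<And>x. x \<in> S \<Longrightarrow> e x < card S"
    using recolor[OF fS] by blast
  obtain n where n: "\<And>\<chi> :: nat list \<Rightarrow> nat. \<forall>g. \<chi> g < card S \<Longrightarrow>
     \<exists>w. param_word a m w \<and> length w \<le> n \<and>
       (\<forall>g. set g \<subseteq> {..<a} \<longrightarrow> length g \<le> m \<longrightarrow>
          \<chi> (param_subst [0..<a] g w) = \<chi> (param_subst [0..<a] (map c g) w))"
    using Suc by meson
  define U where "U = {u. set u \<subseteq> {..<a} \<and> length u \<le> n}"
  have fU: "finite U" unfolding U_def by (rule finite_lists_length_le) simp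
  \<comment> \<open>The number of colour patterns on the continuations in \<open>U\<close>; among
    the N + 1 words \<open>v 0\<close>, ..., \<open>v N\<close> two must share a pattern.\<close>
  define N where "N = card (U \<rightarrow>\<^sub>E {..<R})"
  show ?case
  proof (intro exI[of _ "N + n"] allI impI)
    fix \<chi> :: "nat list \<Rightarrow> nat" assume \<chi>: "\<forall>g. \<chi> g < R"
    define v where "v i = replicate i (Suc b) @ replicate (N - i) b" for i
    define F where "F i = restrict (\<lambda>u. \<chi> (v i @ u)) U" for i
    have "F ` {..N} \<subseteq> U \<rightarrow>\<^sub>E {..<R}" using \<chi> by (auto simp: F_def)
    then have "card (F ` {..N}) \<le> N"
      unfolding N_def by (intro card_mono finite_PiE fU) auto
    then have "\<not> inj_on F {..N}" by (intro pigeonhole) simp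
    then obtain i j where ij: "i < j" "j \<le> N" "F i = F j"
      by (smt (verit) atMost_iff inj_onI linorder_neqE_nat)
    \<comment> \<open>The words \<open>v i\<close> and \<open>v j\<close> differ only from position
      i up to j, where the first has b and the second \<open>Suc b\<close>; \<open>L x\<close> fills
      this stretch with x. As \<open>F i = F j\<close>, no continuation in \<open>U\<close> tells
      \<open>L b\<close> from \<open>L (Suc b)\<close>.\<close>
    define L where "L x = replicate i (Suc b) @ replicate (j - i) x @ replicate (N - j) b" for x
    have "replicate (N - i) b = replicate (j - i) b @ replicate (N - j) b"
      using ij by (simp add: replicate_add[symmetric])
    then have Lb: "L b = v i" by (simp add: L_def v_def)
    have "replicate j (Suc b) = replicate i (Suc b) @ replicate (j - i) (Suc b)"
      using ij by (simp add: replicate_add[symmetric])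
    then have LS: "L (Suc b) = v j" by (simp add: L_def v_def)
    have sw: "\<chi> (L (c x) @ u) = \<chi> (L x @ u)" if "u \<in> U" for x u
      using fun_cong[OF ij(3), of u] that Lb LS by (auto simp: F_def c_def)
    \<comment> \<open>One colour records \<chi> for every choice of the first letter, so a single
      \<open>w\<close> from the induction hypothesis serves all of them.\<close>
    define \<chi>' where "\<chi>' u = e (map (\<lambda>x. \<chi> (L x @ u)) [0..<a])" for u
    have inS: "map (\<lambda>x. \<chi> (L x @ u)) [0..<a] \<in> S" for u using \<chi> by (auto simp: S_def)
    then have "\<forall>u. \<chi>' u < card S" using e(2) by (simp add: \<chi>'_def)
    then obtain w where w: "param_word a m w" "length w \<le> n" and
      w': "\<And>g. set g \<subseteq> {..<a} \<Longrightarrow> length g \<le> m \<Longrightarrow>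
          \<chi>' (param_subst [0..<a] g w) = \<chi>' (param_subst [0..<a] (map c g) w)"
      using n by meson
    define W where "W = L a @ map (skip a) w"
    have Lexp: "L a = replicate i (Suc b) @ a # (replicate (j - i - 1) a @ replicate (N - j) b)"
      using ij by (cases "j - i") (auto simp: L_def)
    have rW: "param_word a (Suc m) W"
    proof -
      have "set (replicate (j - i - 1) a @ replicate (N - j) b) \<subseteq> {..<Suc a}"
        "set (replicate i (Suc b)) \<subseteq> {..<a}" by (auto simp: a_def)
      then show ?thesis
        unfolding W_def Lexp using param_word_skip[OF w(1) order_refl]
          param_word_const_append[of "replicate (j - i - 1) a @ replicate (N - j) b" "Suc a" m "map (skip a) w"]
        by (simp add: param_word_const_append)
    qed
    have sub: "param_subst [0..<a] (x # g) W = L x @ param_subst [0..<a] g w" for x g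
    proof -
      have "param_subst [0..<a] (x # g) W
          = replicate i (Suc b) @ x # param_subst ([0..<a] @ [x]) g ((replicate (j - i - 1) a @ replicate (N - j) b) @ map (skip a) w)"
        using subst_const_append[of "replicate i (Suc b)" "[0..<a]"]
        unfolding W_def Lexp by (simp add: a_def subset_iff nth_append del: upt_Suc)
      also have "\<dots> = replicate i (Suc b) @ x # (replicate (j - i - 1) x @ replicate (N - j) b) @ param_subst [0..<a] g w"
        by (subst subst_const_append)
          (auto simp: subst_skip_upt a_def nth_append simp del: upt_Suc)
      also have "\<dots> = L x @ param_subst [0..<a] g w"
        using ij by (cases "j - i") (auto simp: L_def)
      finally show ?thesis .
    qed
    show "\<exists>w. param_word a (Suc m) w \<and> length w \<le> N + n \<and>
       (\<forall>g. set g \<subseteq> {..<a} \<longrightarrow> length g \<le> Suc m \<longrightarrow>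
          \<chi> (param_subst [0..<a] g w) = \<chi> (param_subst [0..<a] (map c g) w))"
    proof (intro exI[of _ W] conjI allI impI rW)
      show "length W \<le> N + n" using ij w by (simp add: W_def L_def)
      fix g assume g: "set g \<subseteq> {..<a}" "length g \<le> Suc m"
      show "\<chi> (param_subst [0..<a] g W) = \<chi> (param_subst [0..<a] (map c g) W)"
      proof (cases g)
        case (Cons x g')
        have g': "set g' \<subseteq> {..<a}" "length g' \<le> m" "x < a" using g Cons by auto
        have "set (map c g') \<subseteq> {..<a}" using g'(1) by (auto simp: c_def a_def)
        then have "param_subst [0..<a] (map c g') w \<in> U"
          using set_subst[of "[0..<a]" "map c g'" w] length_subst[of "[0..<a]" "map c g'" w] w(2)
          unfolding U_def by force
        \<comment> \<open>The tail is changed first, with the letter x kept, and the first letter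
          afterwards; hence the continuation here is the changed tail.\<close>
        note 1 = sw[OF this, of x]
        have "map (\<lambda>x. \<chi> (L x @ param_subst [0..<a] g' w)) [0..<a]
            = map (\<lambda>x. \<chi> (L x @ param_subst [0..<a] (map c g') w)) [0..<a]"
          by (rule inj_onD[OF e(1) w'[OF g'(1,2), unfolded \<chi>'_def] inS inS])
        then have "\<chi> (L x @ param_subst [0..<a] g' w) = \<chi> (L x @ param_subst [0..<a] (map c g') w)"
          using g'(3) by (simp add: map_eq_conv)
        then show ?thesis using 1 by (simp add: Cons sub)
      qed simp
    qed
  qed
qed

text \<open>If \<open>length g < m\<close>, the result is as long as the part of \<open>w\<close>
  before the first occurrence of the next parameter; if \<open>length g = m\<close>, it is as long
  as \<open>w\<close>. These m + 1 lengths can be placed at elements of \<open>S\<close>.\<close>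

lemma prescribed_lengths:
  "finite S \<Longrightarrow> m < card S \<Longrightarrow> \<exists>w. param_word 1 m w \<and> length w \<le> Max S \<and>
     (\<forall>g. length g \<le> m \<longrightarrow> length (param_subst [0] g w) \<in> S)"
proof (induction m arbitrary: S)
  case 0
  then obtain s where s: "s \<in> S" by fastforce
  have "length (param_subst [0] g (replicate s 0)) = s" for g by (induction s) auto
  then show ?case using s 0 by (intro exI[of _ "replicate s 0"]) (auto simp: param_word_0_iff)
next
  case (Suc m)
  define s where "s = Min S"
  \<comment> \<open>The first parameter stands at position s, the least element of \<open>S\<close>;
    the other lengths are counted from behind the s zeros and this parameter.\<close>
  define T where "T = (\<lambda>t. t - Suc s) ` (S - {s})"
  have sS: "s \<in> S" "\<And>t. t \<in> S \<Longrightarrow> s \<le> t" using Suc.prems by (auto simp: s_def intro: Min_in)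
  have gt: "s < t" if "t \<in> S - {s}" for t using sS(2)[of t] that by auto
  have "inj_on (\<lambda>t. t - Suc s) (S - {s})"
    by (rule inj_onI) (metis Suc_leI diff_add_inverse2 gt le_add_diff_inverse2)
  then have cT: "finite T" "m < card T" using Suc.prems sS by (auto simp: T_def card_image)
  obtain w where w: "param_word 1 m w" "length w \<le> Max T"
    "\<And>g. length g \<le> m \<Longrightarrow> length (param_subst [0] g w) \<in> T"
    using Suc.IH[OF cT] by blast
  have TS: "Suc (s + t) \<in> S" if "t \<in> T" for t using that gt by (force simp: T_def)
  have "Max T \<in> T" using cT by (intro Max_in) auto
  then have le: "Suc (s + Max T) \<le> Max S" using TS Suc.prems by (intro Max_ge) auto
  define W where "W = replicate s 0 @ 1 # map (skip 1) w"
  have sub: "param_subst [0] g W = replicate s 0 @ param_subst [0] g (1 # map (skip 1) w)" for g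
    using subst_const_append[of "replicate s 0" "[0]"] by (simp add: W_def subset_iff)
  have "param_word 1 (Suc m) W" using param_word_skip[OF w(1) order_refl] param_word_const_append[of "replicate s 0" 1]
    by (simp add: W_def subset_iff)
  moreover have "length W \<le> Max S" using w(2) le by (simp add: W_def)
  moreover have "length (param_subst [0] g W) \<in> S" if g: "length g \<le> Suc m" for g
  proof (cases g)
    case Nil
    then show ?thesis using sS by (simp add: sub)
  next
    case (Cons x g')
    have "param_subst ([0] @ [x]) g' (map (skip 1) w) = param_subst [0] g' w"
      using subst_skip_upt[of 1 x g' w] by simp
    then have "param_subst [0] g W = replicate s 0 @ x # param_subst [0] g' w"
      by (simp add: sub Cons)
    then show ?thesis using TS w(3)[of g'] g Cons by simp
  qed
  ultimately show ?case by blast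
qed

text \<open>Constant words over one letter are determined by their length. Some colour occurs at
  more than m of the R * m + 1 lengths, and \<open>prescribed_lengths\<close> stays within
  these.\<close>

lemma graham_rothschild_1_0: "graham_rothschild 1 0"
  unfolding graham_rothschild_def
proof (intro allI)
  fix R m
  show "\<exists>n. \<forall>\<chi> :: nat list \<Rightarrow> nat. (\<forall>g. \<chi> g < R) \<longrightarrow>
     (\<exists>w. param_word 1 m w \<and> length w \<le> n \<and>
       (\<forall>g h. param_word 1 0 g \<longrightarrow> param_word 1 0 h \<longrightarrow> length g \<le> m \<longrightarrow> length h \<le> m \<longrightarrow>
          \<chi> (param_subst [0..<1] g w) = \<chi> (param_subst [0..<1] h w)))"
  proof (intro exI[of _ "R * m"] allI impI)
    fix \<chi> :: "nat list \<Rightarrow> nat" assume \<chi>: "\<forall>g. \<chi> g < R"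
    define S where "S y = {j \<in> {..R * m}. \<chi> (replicate j 0) = y}" for y
    have "\<exists>y. m < card (S y)"
    proof (rule ccontr)
      assume "\<not> ?thesis"
      then have "(\<Sum>y<R. card (S y)) \<le> R * m"
        using sum_mono[of "{..<R}" "\<lambda>y. card (S y)" "\<lambda>_. m"] by (simp add: not_less)
      moreover have "card (\<Union>y<R. S y) = (\<Sum>y<R. card (S y))"
        by (rule card_UN_disjoint) (auto simp: S_def)
      moreover have "(\<Union>y<R. S y) = {..R * m}" using \<chi> by (auto simp: S_def)
      ultimately show False by (simp only: card_atMost)
    qed
    then obtain y where y: "m < card (S y)" by blast
    have f: "finite (S y)" by (simp add: S_def)
    obtain w where w: "param_word 1 m w" "length w \<le> Max (S y)"
      "\<And>g. length g \<le> m \<Longrightarrow> length (param_subst [0] g w) \<in> S y"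
      using prescribed_lengths[OF f y] by blast
    have "Max (S y) \<in> S y" using f y by (intro Max_in) auto
    then have "length w \<le> R * m" using w(2) by (simp add: S_def)
    moreover have "\<chi> (param_subst [0] g w) = y" if "param_word 1 0 g" "length g \<le> m" for g
    proof -
      have "set (param_subst [0] g w) \<subseteq> {0}"
        using that set_subst[of "[0]" g w] by (auto simp: param_word_0_iff)
      then have "param_subst [0] g w = replicate (length (param_subst [0] g w)) 0"
        by (intro replicate_eqI) auto
      then show ?thesis using w(3)[OF that(2)] by (simp add: S_def)
    qed
    ultimately show "\<exists>w. param_word 1 m w \<and> length w \<le> R * m \<and>
       (\<forall>g h. param_word 1 0 g \<longrightarrow> param_word 1 0 h \<longrightarrow> length g \<le> m \<longrightarrow> length h \<le> m \<longrightarrow>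
          \<chi> (param_subst [0..<1] g w) = \<chi> (param_subst [0..<1] h w))"
      using w(1) by (intro exI[of _ w]) simp
  qed
qed

text \<open>After \<open>insensitive_subst\<close> the colour cannot distinguish the last two
  letters, so only words over the smaller alphabet remain to be unified. The length bound n of the
  smaller case is the number of parameters required of the insensitive word.\<close>

lemma graham_rothschild_alphabet_Suc:
  assumes "graham_rothschild (Suc b) 0"
  shows "graham_rothschild (Suc (Suc b)) 0"
  unfolding graham_rothschild_def
proof (intro allI)
  fix R m
  let ?a = "Suc (Suc b)" and ?c = "\<lambda>x. if x = Suc b then b else x"
  obtain n where n: "\<And>\<chi> :: nat list \<Rightarrow> nat. \<forall>g. \<chi> g < R \<Longrightarrow>
     \<exists>w. param_word (Suc b) m w \<and> length w \<le> n \<and>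
       (\<forall>g h. param_word (Suc b) 0 g \<longrightarrow> param_word (Suc b) 0 h \<longrightarrow> length g \<le> m \<longrightarrow> length h \<le> m \<longrightarrow>
          \<chi> (param_subst [0..<Suc b] g w) = \<chi> (param_subst [0..<Suc b] h w))"
    using assms unfolding graham_rothschild_def by meson
  obtain n' where n': "\<And>\<chi> :: nat list \<Rightarrow> nat. \<forall>g. \<chi> g < R \<Longrightarrow>
     \<exists>w. param_word ?a n w \<and> length w \<le> n' \<and>
       (\<forall>g. set g \<subseteq> {..<?a} \<longrightarrow> length g \<le> n \<longrightarrow>
          \<chi> (param_subst [0..<?a] g w) = \<chi> (param_subst [0..<?a] (map ?c g) w))"
    using insensitive_subst[of R b n] by meson
  show "\<exists>n. \<forall>\<chi> :: nat list \<Rightarrow> nat. (\<forall>g. \<chi> g < R) \<longrightarrow>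
     (\<exists>w. param_word ?a m w \<and> length w \<le> n \<and>
       (\<forall>g h. param_word ?a 0 g \<longrightarrow> param_word ?a 0 h \<longrightarrow> length g \<le> m \<longrightarrow> length h \<le> m \<longrightarrow>
          \<chi> (param_subst [0..<?a] g w) = \<chi> (param_subst [0..<?a] h w)))"
  proof (intro exI[of _ n'] allI impI)
    fix \<chi> :: "nat list \<Rightarrow> nat" assume \<chi>: "\<forall>g. \<chi> g < R"
    obtain w where w: "param_word ?a n w" "length w \<le> n'" and ins: "\<And>g. set g \<subseteq> {..<?a} \<Longrightarrow>
        length g \<le> n \<Longrightarrow> \<chi> (param_subst [0..<?a] g w) = \<chi> (param_subst [0..<?a] (map ?c g) w)"
      using n'[OF \<chi>] by blast
    obtain v where v: "param_word (Suc b) m v" "length v \<le> n" and mono: "\<And>g h. param_word (Suc b) 0 g \<Longrightarrow>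
        param_word (Suc b) 0 h \<Longrightarrow> length g \<le> m \<Longrightarrow> length h \<le> m \<Longrightarrow>
        \<chi> (param_subst [0..<?a] (param_subst [0..<Suc b] g v) w) = \<chi> (param_subst [0..<?a] (param_subst [0..<Suc b] h v) w)"
      using n[of "\<lambda>u. \<chi> (param_subst [0..<?a] u w)"] \<chi> by blast
    \<comment> \<open>The word \<open>v\<close> read over the larger alphabet; the constant
      \<open>Suc b\<close> does not occur in it.\<close>
    define V where "V = map (skip (Suc b)) v"
    have V: "param_word ?a m V" "length V \<le> n" using param_word_skip[OF v(1) order_refl] v(2) by (auto simp: V_def)
    have eq: "\<chi> (param_subst [0..<?a] g (param_subst [0..<?a] V w))
        = \<chi> (param_subst [0..<?a] (param_subst [0..<Suc b] (map ?c g) v) w)"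
      if g: "param_word ?a 0 g" "length g \<le> m" for g
    proof -
      have "[0..<?a] = [0..<Suc b] @ [Suc b]" by simp
      then have 1: "param_subst [0..<?a] g V = param_subst [0..<Suc b] g v"
        using subst_skip_upt[of "Suc b" "Suc b" g v] by (simp add: V_def del: upt_Suc)
      have 2: "set (param_subst [0..<?a] g V) \<subseteq> {..<?a}"
        using set_subst[of "[0..<?a]" g V] g by (auto simp: param_word_0_iff simp del: upt_Suc)
      have 3: "length (param_subst [0..<?a] g V) \<le> n" using length_subst V(2) order_trans by blast
      have "map ?c [0..<Suc b] = [0..<Suc b]" by (rule map_idI) auto
      then have 4: "map ?c (param_subst [0..<Suc b] g v) = param_subst [0..<Suc b] (map ?c g) v"
        by (simp add: map_subst del: upt_Suc)
      show ?thesis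
        unfolding subst_subst_upt[OF V(1)] ins[OF 2 3] unfolding 1 4 ..
    qed
    show "\<exists>w. param_word ?a m w \<and> length w \<le> n' \<and>
       (\<forall>g h. param_word ?a 0 g \<longrightarrow> param_word ?a 0 h \<longrightarrow> length g \<le> m \<longrightarrow> length h \<le> m \<longrightarrow>
          \<chi> (param_subst [0..<?a] g w) = \<chi> (param_subst [0..<?a] h w))"
    proof (intro exI[of _ "param_subst [0..<?a] V w"] conjI allI impI)
      show "param_word ?a m (param_subst [0..<?a] V w)"
        by (rule param_word_subst[OF w(1) V(1)]) (use V in \<open>auto simp del: upt_Suc\<close>)
      show "length (param_subst [0..<?a] V w) \<le> n'" using length_subst w(2) order_trans by blast
      fix g h assume gh: "param_word ?a 0 g" "param_word ?a 0 h" "length g \<le> m" "length h \<le> m"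
      have c: "param_word (Suc b) 0 (map ?c u)" if "param_word ?a 0 u" for u
        using that by (auto simp: param_word_0_iff subset_iff less_Suc_eq)
      show "\<chi> (param_subst [0..<?a] g (param_subst [0..<?a] V w)) = \<chi> (param_subst [0..<?a] h (param_subst [0..<?a] V w))"
        unfolding eq[OF gh(1,3)] eq[OF gh(2,4)] by (rule mono) (use c gh in auto)
    qed
  qed
qed

lemma graham_rothschild_0: "graham_rothschild (Suc a) 0"
  by (induction a) (use graham_rothschild_1_0 graham_rothschild_alphabet_Suc in auto)

section \<open>Induction on the number of parameters\<close>

text \<open>A word with parameters splits as \<open>v @ a # u\<close> at its first parameter. The hypothesis on the
  alphabet \<open>{..a}\<close> removes the dependence on \<open>u\<close>; \<open>graham_rothschild a 0\<close> afterwards removes the one on \<open>v\<close>.\<close>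

lemma tail_independent:
  assumes graham_rothschild: "graham_rothschild (Suc a) k"
  shows "\<exists>n. \<forall>\<chi> :: nat list \<Rightarrow> nat. (\<forall>g. \<chi> g < R) \<longrightarrow>
     (\<exists>w. param_word a M w \<and> length w \<le> n \<and>
       (\<forall>v u u'. set v \<subseteq> {..<a} \<longrightarrow> param_word (Suc a) k u \<longrightarrow> param_word (Suc a) k u' \<longrightarrow>
          length (v @ a # u) \<le> M \<longrightarrow> length (v @ a # u') \<le> M \<longrightarrow>
          \<chi> (param_subst [0..<a] (v @ a # u) w) = \<chi> (param_subst [0..<a] (v @ a # u') w)))"
proof (induction M arbitrary: R)
  case 0
  show ?case by (intro exI[of _ 0] allI impI exI[of _ "[]"]) simp
next
  case (Suc M)
  define S where "S = {xs. set xs \<subseteq> {..<R} \<and> length xs = a}"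
  have fS: "finite S" unfolding S_def by (rule finite_vectors)
  obtain e :: "nat list \<Rightarrow> nat" where e: "inj_on e S" "\<And>x. x \<in> S \<Longrightarrow> e x < card S"
    using recolor[OF fS] by blast
  obtain n where n: "\<And>\<chi> :: nat list \<Rightarrow> nat. \<forall>g. \<chi> g < card S \<Longrightarrow>
     \<exists>w. param_word a M w \<and> length w \<le> n \<and>
       (\<forall>v u u'. set v \<subseteq> {..<a} \<longrightarrow> param_word (Suc a) k u \<longrightarrow> param_word (Suc a) k u' \<longrightarrow>
          length (v @ a # u) \<le> M \<longrightarrow> length (v @ a # u') \<le> M \<longrightarrow>
          \<chi> (param_subst [0..<a] (v @ a # u) w) = \<chi> (param_subst [0..<a] (v @ a # u') w))"
    using Suc by meson
  obtain n' where n': "\<And>\<chi> :: nat list \<Rightarrow> nat. \<forall>g. \<chi> g < R \<Longrightarrow>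
     \<exists>w. param_word (Suc a) n w \<and> length w \<le> n' \<and>
       (\<forall>g h. param_word (Suc a) k g \<longrightarrow> param_word (Suc a) k h \<longrightarrow> length g \<le> n \<longrightarrow> length h \<le> n \<longrightarrow>
          \<chi> (param_subst [0..<Suc a] g w) = \<chi> (param_subst [0..<Suc a] h w))"
    using graham_rothschild unfolding graham_rothschild_def by meson
  show ?case
  proof (intro exI[of _ "Suc n'"] allI impI)
    fix \<chi> :: "nat list \<Rightarrow> nat" assume \<chi>: "\<forall>g. \<chi> g < R"
    \<comment> \<open>This takes care of words with empty \<open>v\<close>: behind the initial
      \<open>a\<close> that letter acts as a constant, so the hypothesis over the alphabet with
      \<open>Suc a\<close> letters applies.\<close>
    obtain w where w: "param_word (Suc a) n w" "length w \<le> n'" and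
      mono: "\<And>g h. param_word (Suc a) k g \<Longrightarrow> param_word (Suc a) k h \<Longrightarrow> length g \<le> n \<Longrightarrow> length h \<le> n \<Longrightarrow>
          \<chi> (a # param_subst [0..<Suc a] g w) = \<chi> (a # param_subst [0..<Suc a] h w)"
      using n'[of "\<lambda>u. \<chi> (a # u)"] \<chi> by blast
    \<comment> \<open>For nonempty \<open>v\<close> the induction hypothesis treats what follows the
      first letter x, for all x < a at once by a vector of colours.\<close>
    define \<chi>' where "\<chi>' g = e (map (\<lambda>x. \<chi> (x # param_subst ([0..<a] @ [x]) g w)) [0..<a])" for g
    have inS: "map (\<lambda>x. \<chi> (x # param_subst ([0..<a] @ [x]) g w)) [0..<a] \<in> S" for g
      using \<chi> by (auto simp: S_def)
    then have "\<forall>g. \<chi>' g < card S" using e(2) by (simp add: \<chi>'_def)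
    then obtain z where z: "param_word a M z" "length z \<le> n" and
      z': "\<And>v u u'. set v \<subseteq> {..<a} \<Longrightarrow> param_word (Suc a) k u \<Longrightarrow> param_word (Suc a) k u' \<Longrightarrow>
          length (v @ a # u) \<le> M \<Longrightarrow> length (v @ a # u') \<le> M \<Longrightarrow>
          \<chi>' (param_subst [0..<a] (v @ a # u) z) = \<chi>' (param_subst [0..<a] (v @ a # u') z)"
      using n[of \<chi>'] by blast
    \<comment> \<open>The letter \<open>a\<close> now belongs to the initial parameter of
      \<open>W\<close>, so the parameters of \<open>z\<close> move up by one before \<open>z\<close>
      is substituted into \<open>w\<close>.\<close>
    define Z where "Z = map (skip a) z"
    have Z: "param_word (Suc a) M Z" "length Z \<le> n" using param_word_skip[OF z(1) order_refl] z(2) by (auto simp: Z_def)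
    define W where "W = a # param_subst [0..<Suc a] Z w"
    have rW: "param_word a (Suc M) W"
      using param_word_subst[OF w(1) Z(1), of "[0..<Suc a]"] Z(2)
      by (simp add: W_def lessThan_atLeast0 del: upt_Suc)
    have sub: "param_subst [0..<a] (x # g) W = x # param_subst ([0..<a] @ [x]) (param_subst ([0..<a] @ [x]) g Z) w"
      for x g
    proof -
      have "map ((!) ([0..<a] @ [x])) [0..<Suc a] = [0..<a] @ [x]"
        by (auto intro: nth_equalityI simp: nth_append)
      moreover have "set [0..<Suc a] \<subseteq> {..<length ([0..<a] @ [x])}" by auto
      moreover have "param_word (length ([0..<a] @ [x])) M Z" using Z by simp
      ultimately have "param_subst ([0..<a] @ [x]) g (param_subst [0..<Suc a] Z w)
          = param_subst ([0..<a] @ [x]) (param_subst ([0..<a] @ [x]) g Z) w"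
        by (metis subst_subst)
      then show ?thesis by (simp add: W_def del: upt_Suc)
    qed
    show "\<exists>w. param_word a (Suc M) w \<and> length w \<le> Suc n' \<and>
       (\<forall>v u u'. set v \<subseteq> {..<a} \<longrightarrow> param_word (Suc a) k u \<longrightarrow> param_word (Suc a) k u' \<longrightarrow>
          length (v @ a # u) \<le> Suc M \<longrightarrow> length (v @ a # u') \<le> Suc M \<longrightarrow>
          \<chi> (param_subst [0..<a] (v @ a # u) w) = \<chi> (param_subst [0..<a] (v @ a # u') w))"
    proof (intro exI[of _ W] conjI allI impI rW)
      show "length W \<le> Suc n'"
        using length_subst[of "[0..<Suc a]" Z w] w(2) by (simp add: W_def)
      fix v u u'
      assume v: "set v \<subseteq> {..<a}" and u: "param_word (Suc a) k u" "param_word (Suc a) k u'"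
        and l: "length (v @ a # u) \<le> Suc M" "length (v @ a # u') \<le> Suc M"
      show "\<chi> (param_subst [0..<a] (v @ a # u) W) = \<chi> (param_subst [0..<a] (v @ a # u') W)"
      proof (cases v)
        case Nil
        have r: "param_word (Suc a) k (param_subst [0..<Suc a] t Z)" if "param_word (Suc a) k t" "length t \<le> M" for t
          by (rule param_word_subst[OF Z(1) that(1)]) (use that in auto)
        have len: "length (param_subst [0..<Suc a] t Z) \<le> n" for t using length_subst Z(2) order_trans by blast
        have "\<chi> (a # param_subst [0..<Suc a] (param_subst [0..<Suc a] u Z) w)
            = \<chi> (a # param_subst [0..<Suc a] (param_subst [0..<Suc a] u' Z) w)"
          by (rule mono) (use r len u l Nil in auto)
        then show ?thesis using sub[of a] by (simp add: Nil)
      next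
        case (Cons x v')
        have "\<chi>' (param_subst [0..<a] (v' @ a # u) z) = \<chi>' (param_subst [0..<a] (v' @ a # u') z)"
          by (rule z') (use v u l Cons in auto)
        then have "map (\<lambda>x. \<chi> (x # param_subst ([0..<a] @ [x]) (param_subst [0..<a] (v' @ a # u) z) w)) [0..<a]
          = map (\<lambda>x. \<chi> (x # param_subst ([0..<a] @ [x]) (param_subst [0..<a] (v' @ a # u') z) w)) [0..<a]"
          unfolding \<chi>'_def by (rule inj_onD[OF e(1) _ inS inS])
        then have "\<chi> (x # param_subst ([0..<a] @ [x]) (param_subst [0..<a] (v' @ a # u) z) w)
          = \<chi> (x # param_subst ([0..<a] @ [x]) (param_subst [0..<a] (v' @ a # u') z) w)"
          using v Cons by (simp add: map_eq_conv)
        then show ?thesis by (simp add: Cons sub Z_def subst_skip_upt)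
      qed
    qed
  qed
qed

lemma graham_rothschild_param_Suc:
  assumes "graham_rothschild (Suc a) k" and "graham_rothschild a 0"
  shows "graham_rothschild a (Suc k)"
  unfolding graham_rothschild_def
proof (intro allI)
  fix R m
  obtain n where n: "\<And>\<chi> :: nat list \<Rightarrow> nat. \<forall>g. \<chi> g < R \<Longrightarrow>
     \<exists>w. param_word a m w \<and> length w \<le> n \<and>
       (\<forall>g h. param_word a 0 g \<longrightarrow> param_word a 0 h \<longrightarrow> length g \<le> m \<longrightarrow> length h \<le> m \<longrightarrow>
          \<chi> (param_subst [0..<a] g w) = \<chi> (param_subst [0..<a] h w))"
    using assms(2) unfolding graham_rothschild_def by meson
  \<comment> \<open>Room for a prefix of at most n letters and the \<open>Suc k\<close> letters of
    the tail \<open>?t\<close> below.\<close>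
  define M where "M = n + Suc k"
  obtain n' where n': "\<And>\<chi> :: nat list \<Rightarrow> nat. \<forall>g. \<chi> g < R \<Longrightarrow>
     \<exists>w. param_word a M w \<and> length w \<le> n' \<and>
       (\<forall>v u u'. set v \<subseteq> {..<a} \<longrightarrow> param_word (Suc a) k u \<longrightarrow> param_word (Suc a) k u' \<longrightarrow>
          length (v @ a # u) \<le> M \<longrightarrow> length (v @ a # u') \<le> M \<longrightarrow>
          \<chi> (param_subst [0..<a] (v @ a # u) w) = \<chi> (param_subst [0..<a] (v @ a # u') w))"
    using tail_independent[OF assms(1), of R M] by meson
  show "\<exists>n. \<forall>\<chi> :: nat list \<Rightarrow> nat. (\<forall>g. \<chi> g < R) \<longrightarrow>
     (\<exists>w. param_word a m w \<and> length w \<le> n \<and>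
       (\<forall>g h. param_word a (Suc k) g \<longrightarrow> param_word a (Suc k) h \<longrightarrow> length g \<le> m \<longrightarrow> length h \<le> m \<longrightarrow>
          \<chi> (param_subst [0..<a] g w) = \<chi> (param_subst [0..<a] h w)))"
  proof (intro exI[of _ n'] allI impI)
    fix \<chi> :: "nat list \<Rightarrow> nat" assume \<chi>: "\<forall>g. \<chi> g < R"
    obtain w where w: "param_word a M w" "length w \<le> n'" and
      ind: "\<And>v u u'. set v \<subseteq> {..<a} \<Longrightarrow> param_word (Suc a) k u \<Longrightarrow> param_word (Suc a) k u' \<Longrightarrow>
          length (v @ a # u) \<le> M \<Longrightarrow> length (v @ a # u') \<le> M \<Longrightarrow>
          \<chi> (param_subst [0..<a] (v @ a # u) w) = \<chi> (param_subst [0..<a] (v @ a # u') w)"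
      using n'[OF \<chi>] by blast
    \<comment> \<open>By \<open>ind\<close> all tails give the same colour, so this one, with every
      parameter occurring once, can stand for all. What remains is a colouring of constant
      prefixes.\<close>
    let ?t = "a # [Suc a..<Suc a + k]"
    obtain z where z: "param_word a m z" "length z \<le> n" and
      mono: "\<And>g h. param_word a 0 g \<Longrightarrow> param_word a 0 h \<Longrightarrow> length g \<le> m \<Longrightarrow> length h \<le> m \<Longrightarrow>
        \<chi> (param_subst [0..<a] (param_subst [0..<a] g z @ ?t) w) = \<chi> (param_subst [0..<a] (param_subst [0..<a] h z @ ?t) w)"
      using n[of "\<lambda>v. \<chi> (param_subst [0..<a] (v @ ?t) w)"] \<chi> by blast
    have canon: "\<exists>v. param_word a 0 v \<and> length v \<le> m \<and> \<chi> (param_subst [0..<a] g (param_subst [0..<a] z w))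
        = \<chi> (param_subst [0..<a] (param_subst [0..<a] v z @ ?t) w)"
      if g: "param_word a (Suc k) g" "length g \<le> m" for g
    proof -
      obtain v u where vu: "g = v @ a # u" "set v \<subseteq> {..<a}" "param_word (Suc a) k u"
        using param_word_SucE[OF g(1)] .
      \<comment> \<open>Substitution into \<open>z\<close> preserves the splitting at the first
        parameter, and the new prefix depends on \<open>v\<close> alone because it is the truncated
        substitution of \<open>v\<close>.\<close>
      obtain y where y: "param_subst [0..<a] g z = param_subst [0..<a] v z @ a # y"
        using subst_append[of "[0..<a]" m z v a u] z(1) g(2) vu(1) by auto
      have sv: "set (param_subst [0..<a] v z) \<subseteq> {..<a}" using set_subst[of "[0..<a]" v z] vu(2) by auto
      have "param_word a (Suc k) (param_subst [0..<a] g z)"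
        by (rule param_word_subst[OF z(1) g(1)]) (use g in auto)
      then have ry: "param_word (Suc a) k y" unfolding y using sv by (simp add: param_word_const_append)
      have "length (param_subst [0..<a] v z) \<le> n" using length_subst z(2) order_trans by blast
      moreover have "length (param_subst [0..<a] v z @ a # y) \<le> n"
        unfolding y[symmetric] using length_subst z(2) order_trans by blast
      ultimately have "\<chi> (param_subst [0..<a] (param_subst [0..<a] v z @ a # y) w)
          = \<chi> (param_subst [0..<a] (param_subst [0..<a] v z @ ?t) w)"
        using param_word_upt[of "Suc a" k] by (intro ind sv ry) (auto simp: M_def)
      moreover have "param_subst [0..<a] g (param_subst [0..<a] z w) = param_subst [0..<a] (param_subst [0..<a] v z @ a # y) w"
        using subst_subst_upt[OF z(1)] y by simp
      ultimately show ?thesis using vu g by (intro exI[of _ v]) (auto simp: param_word_0_iff)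
    qed
    show "\<exists>w. param_word a m w \<and> length w \<le> n' \<and>
       (\<forall>g h. param_word a (Suc k) g \<longrightarrow> param_word a (Suc k) h \<longrightarrow> length g \<le> m \<longrightarrow> length h \<le> m \<longrightarrow>
          \<chi> (param_subst [0..<a] g w) = \<chi> (param_subst [0..<a] h w))"
    proof (intro exI[of _ "param_subst [0..<a] z w"] conjI allI impI)
      show "param_word a m (param_subst [0..<a] z w)"
        by (rule param_word_subst[OF w(1) z(1)]) (use z in \<open>auto simp: M_def\<close>)
      show "length (param_subst [0..<a] z w) \<le> n'" using length_subst w(2) order_trans by blast
      show "\<chi> (param_subst [0..<a] g (param_subst [0..<a] z w)) = \<chi> (param_subst [0..<a] h (param_subst [0..<a] z w))"
        if "param_word a (Suc k) g" "param_word a (Suc k) h" "length g \<le> m" "length h \<le> m" for g h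
        using canon[OF that(1,3)] canon[OF that(2,4)] mono by metis
    qed
  qed
qed

lemma graham_rothschild: "graham_rothschild (Suc a) k"
  by (induction k arbitrary: a) (use graham_rothschild_0 graham_rothschild_param_Suc in auto)

section \<open>The finite dual Ramsey theorem for words\<close>

lemma dual_ramsey_words:
  assumes "p > 0" "m > 0"
  shows "\<exists>n>0. \<forall>\<chi> :: nat list \<Rightarrow> nat. (\<forall>g. \<chi> g < R) \<longrightarrow>
    (\<exists>w. param_word 0 m w \<and> length w = n \<and>
      (\<exists>c. \<forall>g. param_word 0 p g \<longrightarrow> length g = m \<longrightarrow> \<chi> (map ((!) g) w) = c))"
proof -
  obtain p' m' where pm: "p = Suc p'" "m = Suc m'" using assms by (metis gr0_implies_Suc)
  obtain n where n: "\<And>\<chi> :: nat list \<Rightarrow> nat. \<forall>g. \<chi> g < R \<Longrightarrow>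
     \<exists>w. param_word 1 m' w \<and> length w \<le> n \<and>
       (\<forall>g h. param_word 1 p' g \<longrightarrow> param_word 1 p' h \<longrightarrow> length g \<le> m' \<longrightarrow> length h \<le> m' \<longrightarrow>
          \<chi> (param_subst [0..<1] g w) = \<chi> (param_subst [0..<1] h w))"
    using graham_rothschild[of 0 p'] unfolding graham_rothschild_def One_nat_def by meson
  show ?thesis
  proof (intro exI[of _ "Suc n"] conjI allI impI)
    fix \<chi> :: "nat list \<Rightarrow> nat" assume \<chi>: "\<forall>g. \<chi> g < R"
    \<comment> \<open>The leading 0 is the forced first letter. The trailing zeros give all words
      the length \<open>Suc n\<close>; since \<open>g ! 0 = 0\<close>, composition with
      \<open>g\<close> leaves the padding unchanged.\<close>
    define pad where "pad v = 0 # v @ replicate (n - length v) (0::nat)" for v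
    obtain w where w: "param_word 1 m' w" "length w \<le> n" and
      mono: "\<And>g h. param_word 1 p' g \<Longrightarrow> param_word 1 p' h \<Longrightarrow> length g \<le> m' \<Longrightarrow> length h \<le> m' \<Longrightarrow>
          \<chi> (pad (param_subst [0] g w)) = \<chi> (pad (param_subst [0] h w))"
      using n[of "\<lambda>v. \<chi> (pad v)"] \<chi> by auto
    have eq: "\<exists>g'. param_word 1 p' g' \<and> length g' \<le> m' \<and> map ((!) g) (pad w) = pad (param_subst [0] g' w)"
      if g: "param_word 0 p g" "length g = m" for g
    proof -
      obtain g' where g': "g = 0 # g'" "param_word 1 p' g'" using g pm by (cases g) auto
      have "param_subst [0] g' w = map ((!) g) w"
        using subst_eq_map[of "[0]" m' w g'] w g g' pm by simp
      then show ?thesis using g' g pm by (auto simp: pad_def)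
    qed
    show "\<exists>w. param_word 0 m w \<and> length w = Suc n \<and>
      (\<exists>c. \<forall>g. param_word 0 p g \<longrightarrow> length g = m \<longrightarrow> \<chi> (map ((!) g) w) = c)"
    proof (intro exI[of _ "pad w"] conjI)
      have "set (replicate (n - length w) 0) \<subseteq> {..<1::nat}" by auto
      then show "param_word 0 m (pad w)" using param_word_append_const[OF w(1)] by (simp add: pad_def pm)
      show "length (pad w) = Suc n" using w(2) by (simp add: pad_def)
      show "\<exists>c. \<forall>g. param_word 0 p g \<longrightarrow> length g = m \<longrightarrow> \<chi> (map ((!) g) (pad w)) = c"
        using eq mono by metis
    qed
  qed simp
qed

text \<open>For a = 0 the first two conditions say that the word is onto \<open>{..<k}\<close>, and
  the third, that all smaller letters have occurred before, is rigidity.\<close>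

lemma param_word_iff:
  "param_word a k w \<longleftrightarrow> set w \<subseteq> {..<a + k} \<and> {a..<a + k} \<subseteq> set w \<and>
     (\<forall>j<length w. {a..<w ! j} \<subseteq> set (take j w))"
proof (induction w arbitrary: a k)
  case (Cons x w)
  have all: "(\<forall>j<length (x # w). {a..<(x # w) ! j} \<subseteq> set (take j (x # w))) \<longleftrightarrow>
      x \<le> a \<and> (\<forall>j<length w. {a..<w ! j} \<subseteq> insert x (set (take j w)))"
    by (auto simp: All_less_Suc2)
  consider "x < a" | "x = a" | "x > a" by linarith
  then show ?case
  proof cases
    case 1
    then have "{a..<c} \<subseteq> insert x C \<longleftrightarrow> {a..<c} \<subseteq> C" for c C
      by (simp add: subset_insert)
    then
    show ?thesis unfolding all using 1 Cons[of a k] by simp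
  next
    case 2
    have "{a..<c} \<subseteq> insert a C \<longleftrightarrow> {Suc a..<c} \<subseteq> C" for c C
    proof -
      have "{a..<c} - {a} = {Suc a..<c}" by auto
      then show ?thesis by blast
    qed
    then show ?thesis unfolding all using 2 Cons[of "Suc a" "k - 1"] by (cases k) auto
  next
    case 3
    then show ?thesis unfolding all by auto
  qed
qed auto

lemma param_word_0_earlier:
  assumes "param_word 0 k w" "j < length w" "x < w ! j"
  obtains i where "i < j" "w ! i = x"
proof -
  have "x \<in> set (take j w)" using assms by (auto simp: param_word_iff subset_iff)
  then show thesis using that by (auto simp: in_set_conv_nth)
qed

subsection \<open>Enumerating chains and edges\<close>

definition chain_enum :: "'a rel \<Rightarrow> 'a set \<Rightarrow> 'a list" where
  "chain_enum lt S = (SOME xs. set xs = S \<and> sorted_wrt (\<lambda>x y. (x, y) \<in> lt) xs)"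

lemma sorted_list_exists:
  assumes "finite S" "trans lt" "total_on S lt"
  shows "\<exists>xs. set xs = S \<and> sorted_wrt (\<lambda>x y. (x, y) \<in> lt) xs"
  using assms
proof (induction "card S" arbitrary: S)
  case (Suc n)
  then have "S \<noteq> {}" by auto
  then obtain m where m: "m \<in> S" "\<forall>s\<in>S. s \<noteq> m \<longrightarrow> (m, s) \<in> lt"
    using ex_min Suc.prems by metis
  have "n = card (S - {m})" using Suc.hyps(2) m Suc.prems by simp
  moreover have "total_on (S - {m}) lt" using Suc.prems by (auto simp: total_on_def)
  ultimately obtain xs where "set xs = S - {m}" "sorted_wrt (\<lambda>x y. (x, y) \<in> lt) xs"
    using Suc.hyps(1)[of "S - {m}"] Suc.prems by auto
  then show ?case using m by (intro exI[of _ "m # xs"]) auto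
qed simp

lemma chain_enum:
  assumes "finite S" "trans lt" "total_on S lt"
  shows "set (chain_enum lt S) = S" "sorted_wrt (\<lambda>x y. (x, y) \<in> lt) (chain_enum lt S)"
  using someI_ex[OF sorted_list_exists[OF assms]] by (auto simp: chain_enum_def)

text \<open>Makes the choice in \<open>chain_enum\<close> harmless: an increasing image of an
  enumeration is again the enumeration of its set.\<close>

lemma sorted_wrt_unique:
  assumes "trans lt" "irrefl lt"
  shows "sorted_wrt (\<lambda>x y. (x, y) \<in> lt) xs \<Longrightarrow> sorted_wrt (\<lambda>x y. (x, y) \<in> lt) ys \<Longrightarrow>
    set xs = set ys \<Longrightarrow> xs = ys"
proof (induction xs arbitrary: ys)
  case (Cons x xs)
  then obtain y zs where ys: "ys = y # zs" by (cases ys) auto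
  have asym: "(v, u) \<notin> lt" if "(u, v) \<in> lt" for u v using that assms by (meson irrefl_def transD)
  have "x = y" using Cons.prems ys asym by auto (metis insert_iff)
  moreover have "x \<notin> set xs" "y \<notin> set zs"
    using Cons.prems ys assms(2) by (auto simp: irrefl_def)
  ultimately have "set xs = set zs" using Cons.prems(3) ys by auto
  then show ?case using Cons ys \<open>x = y\<close> by auto
qed simp

lemma sorted_wrt_nth_less_iff:
  assumes "trans lt" "irrefl lt" "sorted_wrt (\<lambda>x y. (x, y) \<in> lt) xs" "i < length xs" "j < length xs"
  shows "(xs ! i, xs ! j) \<in> lt \<longleftrightarrow> i < j"
  using assms sorted_wrt_nth_less[OF assms(3)] by (metis irrefl_def linorder_neqE_nat transD)

lemma sorted_wrt_distinct:
  "irrefl lt \<Longrightarrow> sorted_wrt (\<lambda>x y. (x, y) \<in> lt) xs \<Longrightarrow> distinct xs"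
  by (induction xs) (auto simp: irrefl_def)

text \<open>A preimage of x before every preimage of y lies in particular before the least one, so
  no minimum has to be computed. \<open>rigid_surjection_earlier\<close> is the converse.\<close>

lemma rigid_surjectionI:
  assumes "finite X" "trans lx" "irrefl lx" "total_on X lx" "f ` X = Y"
    and "\<And>x y b. x \<in> Y \<Longrightarrow> y \<in> Y \<Longrightarrow> (x, y) \<in> ly \<Longrightarrow> b \<in> X \<Longrightarrow> f b = y \<Longrightarrow> \<exists>a\<in>X. f a = x \<and> (a, b) \<in> lx"
  shows "rigid_surjection X lx Y ly f"
  unfolding rigid_surjection_def
proof (intro conjI ballI impI assms(5))
  have m: "chain_min lx {a\<in>X. f a = b} \<in> {a\<in>X. f a = b} \<and>
      (\<forall>s\<in>{a\<in>X. f a = b}. s \<noteq> chain_min lx {a\<in>X. f a = b} \<longrightarrow> (chain_min lx {a\<in>X. f a = b}, s) \<in> lx)"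
    if "b \<in> Y" for b using that assms(1-5) by (intro chain_min) (auto simp: total_on_def)
  fix x y assume xy: "x \<in> Y" "y \<in> Y" "(x, y) \<in> ly"
  obtain a where a: "a \<in> X" "f a = x" "(a, chain_min lx {a\<in>X. f a = y}) \<in> lx"
    using assms(6)[OF xy] m[OF xy(2)] by blast
  show "(chain_min lx {a \<in> X. f a = x}, chain_min lx {a \<in> X. f a = y}) \<in> lx"
  proof (cases "a = chain_min lx {a \<in> X. f a = x}")
    case False
    then show ?thesis using m[OF xy(1)] a transD[OF assms(2)] by blast
  qed (use a in simp)
qed

lemma rigid_surjection_earlier:
  assumes "finite X" "trans lx" "irrefl lx" "total_on X lx" and f: "rigid_surjection X lx Y ly f"
    and xy: "x \<in> Y" "(x, f b) \<in> ly" "b \<in> X"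
  shows "\<exists>a\<in>X. f a = x \<and> (a, b) \<in> lx"
proof -
  have fX: "f ` X = Y" using f by (simp add: rigid_surjection_def)
  have m: "chain_min lx {a\<in>X. f a = b} \<in> {a\<in>X. f a = b} \<and>
      (\<forall>s\<in>{a\<in>X. f a = b}. s \<noteq> chain_min lx {a\<in>X. f a = b} \<longrightarrow> (chain_min lx {a\<in>X. f a = b}, s) \<in> lx)"
    if "b \<in> Y" for b using that assms(1-4) fX by (intro chain_min) (auto simp: total_on_def)
  have y: "f b \<in> Y" using fX xy by auto
  have "(chain_min lx {a\<in>X. f a = x}, chain_min lx {a\<in>X. f a = f b}) \<in> lx"
    using f xy y by (auto simp: rigid_surjection_def)
  moreover have "b = chain_min lx {a\<in>X. f a = f b} \<or> (chain_min lx {a\<in>X. f a = f b}, b) \<in> lx"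
    using m[OF y] xy by auto
  ultimately have "(chain_min lx {a\<in>X. f a = x}, b) \<in> lx" using transD[OF assms(2)] by metis
  then show ?thesis using m[OF xy(1)] by blast
qed

section \<open>Enumerated edges and quotient maps from boxes\<close>

abbreviation sal_of :: "'a ohgr \<Rightarrow> 'a set rel" where
  "sal_of H \<equiv> sal (verts H) (ord H)"

definition edge_list :: "'a ohgr \<Rightarrow> 'a set list" where
  "edge_list H = chain_enum (sal_of H) (edges H)"

text \<open>Loops are turned into constant tuples, so that the image of a tuple under a strong rigid
  quotient map is again the tuple of an edge.\<close>

definition edge_tuple :: "nat \<Rightarrow> 'a ohgr \<Rightarrow> 'a set \<Rightarrow> 'a list" where
  "edge_tuple r H e = (if card e = 1 then replicate r (the_elem e) else chain_enum (ord H) e)"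

definition nat_less :: "nat \<Rightarrow> nat rel" where
  "nat_less n = {(x, y). x < y \<and> y < n}"

lemma nat_less_chain: "finite_chain {..<n} (nat_less n)"
  by (auto simp: finite_chain_def strict_linear_order_on_def nat_less_def trans_def irrefl_def total_on_def)

definition chain_box :: "nat \<Rightarrow> nat \<Rightarrow> (nat \<times> nat) ohgr" where
  "chain_box r n = boxtimes r {..<n} (nat_less n)"

lemma chain_box_Ob: "fin_ordered_refl_hypergraph r (chain_box r n)"
  using boxtimes_Ob[OF nat_less_chain] by (simp add: OHgr_srq_def chain_box_def)

text \<open>Block j goes onto the edge with number \<open>w ! j\<close>. Vertices of a block are
  counted from 1 and list entries from 0, hence \<open>i - 1\<close>.\<close>

definition block_map :: "nat \<Rightarrow> 'a ohgr \<Rightarrow> nat list \<Rightarrow> nat \<times> nat \<Rightarrow> 'a" where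
  "block_map r H w = (\<lambda>(i, j) \<in> {1..r} \<times> {..<length w}. edge_tuple r H (edge_list H ! (w ! j)) ! (i - 1))"

locale ordered_hypergraph =
  fixes r :: nat and H :: "'a ohgr"
  assumes r: "r \<ge> 2" and H: "fin_ordered_refl_hypergraph r H"
begin

lemma ord: "trans (ord H)" "irrefl (ord H)" "total_on (verts H) (ord H)" "finite (verts H)"
  "ord H \<subseteq> verts H \<times> verts H" "finite_chain (verts H) (ord H)"
  using H by (auto simp: fin_ordered_refl_hypergraph_def finite_chain_def strict_linear_order_on_def)

lemma sal: "trans (sal_of H)" "irrefl (sal_of H)" "total_on (edges H) (sal_of H)" "finite (edges H)"
  using edges_chain[OF H] by (auto simp: strict_linear_order_on_def)

lemma edge_cases:
  assumes "e \<in> edges H"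
  obtains v where "v \<in> verts H" "e = {v}" | "e \<subseteq> verts H" "card e = r" "card e > 1"
proof -
  have "e \<in> [verts H]\<^bsup>1\<^esup> \<or> e \<in> [verts H]\<^bsup>r\<^esup>"
    using assms H by (auto simp: fin_ordered_refl_hypergraph_def)
  then show thesis using that r by (auto simp: nsets_def card_1_singleton_iff)
qed

lemma singleton_edge: "v \<in> verts H \<Longrightarrow> {v} \<in> edges H"
  using H by (auto simp: fin_ordered_refl_hypergraph_def nsets_def)

lemma edge_list: "set (edge_list H) = edges H" "sorted_wrt (\<lambda>x y. (x, y) \<in> sal_of H) (edge_list H)"
  "distinct (edge_list H)" "length (edge_list H) = card (edges H)"
proof -
  show 1: "set (edge_list H) = edges H" "sorted_wrt (\<lambda>x y. (x, y) \<in> sal_of H) (edge_list H)"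
    unfolding edge_list_def using chain_enum sal by blast+
  show 2: "distinct (edge_list H)" using sorted_wrt_distinct[OF sal(2) 1(2)] .
  show "length (edge_list H) = card (edges H)" using distinct_card[OF 2] 1 by simp
qed

lemma edge_list_nth: "q < card (edges H) \<Longrightarrow> edge_list H ! q \<in> edges H"
  using edge_list by (metis nth_mem)

lemma edge_list_less_iff:
  "p < card (edges H) \<Longrightarrow> q < card (edges H) \<Longrightarrow> (edge_list H ! p, edge_list H ! q) \<in> sal_of H \<longleftrightarrow> p < q"
  using sorted_wrt_nth_less_iff[OF sal(1,2) edge_list(2)] edge_list(4) by simp

lemma edge_index:
  assumes "e \<in> edges H" obtains q where "q < card (edges H)" "edge_list H ! q = e"
  using assms edge_list by (metis in_set_conv_nth)

lemma edge_enum: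
  assumes "e \<in> edges H"
  shows "set (chain_enum (ord H) e) = e" "sorted_wrt (\<lambda>x y. (x, y) \<in> ord H) (chain_enum (ord H) e)"
    "length (chain_enum (ord H) e) = card e"
proof -
  have e: "e \<subseteq> verts H" using edges_chain(3)[OF H] assms by auto
  then have *: "finite e" "total_on e (ord H)" using ord by (auto simp: total_on_def finite_subset)
  show 1: "set (chain_enum (ord H) e) = e" "sorted_wrt (\<lambda>x y. (x, y) \<in> ord H) (chain_enum (ord H) e)"
    using chain_enum[OF *(1) ord(1) *(2)] by auto
  show "length (chain_enum (ord H) e) = card e"
    using distinct_card[OF sorted_wrt_distinct[OF ord(2) 1(2)]] 1 by simp
qed

lemma edge_tuple:
  assumes "e \<in> edges H"
  shows "set (edge_tuple r H e) = e" "length (edge_tuple r H e) = r"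
  using assms edge_enum[OF assms] r
  by (cases rule: edge_cases[OF assms]; auto simp: edge_tuple_def)+

context
  fixes w :: "nat list" assumes w: "param_word 0 (card (edges H)) w"
begin

lemma w_less: "j < length w \<Longrightarrow> w ! j < card (edges H)"
  using w by (auto simp: param_word_iff subset_iff)

lemma block_map_in:
  assumes "i \<in> {1..r}" "j < length w"
  shows "block_map r H w (i, j) \<in> edge_list H ! (w ! j)"
proof -
  have "edge_tuple r H (edge_list H ! (w ! j)) ! (i - 1) \<in> edge_list H ! (w ! j)"
    using edge_tuple[OF edge_list_nth[OF w_less[OF assms(2)]]] assms
    by (metis atLeastAtMost_iff diff_less le_trans less_le_trans less_one nat_less_le not_le nth_mem zero_less_one)
  then show ?thesis using assms by (simp add: block_map_def)
qed

lemma block_map_image: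
  assumes "j < length w"
  shows "block_map r H w ` ({1..r} \<times> {j}) = edge_list H ! (w ! j)"
proof -
  note t = edge_tuple[OF edge_list_nth[OF w_less[OF assms]]]
  have "block_map r H w ` ({1..r} \<times> {j}) = (\<lambda>i. edge_tuple r H (edge_list H ! (w ! j)) ! (i - 1)) ` Suc ` {..<r}"
    using assms by (force simp: block_map_def image_Suc_lessThan image_image)
  also have "\<dots> = set (edge_tuple r H (edge_list H ! (w ! j)))"
    by (auto simp: image_image set_conv_nth t(2) image_iff)
  finally show ?thesis using t by simp
qed

lemma box_edge_cases:
  assumes "b \<in> edges (chain_box r (length w))"
  obtains i j where "i \<in> {1..r}" "j < length w" "b = {(i, j)}"
    | j where "j < length w" "b = {1..r} \<times> {j}"
  using assms by (auto simp: chain_box_def boxtimes_def nsets_def card_1_singleton_iff)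

lemma box_edges:
  "i \<in> {1..r} \<Longrightarrow> j < length w \<Longrightarrow> {(i, j)} \<in> edges (chain_box r (length w))"
  "j < length w \<Longrightarrow> {1..r} \<times> {j} \<in> edges (chain_box r (length w))"
  by (auto simp: chain_box_def boxtimes_def nsets_def)

lemma block_map_edge:
  assumes "b \<in> edges (chain_box r (length w))"
  shows "block_map r H w ` b \<in> edges H"
  using assms
proof (cases rule: box_edge_cases)
  case (1 i j)
  have "block_map r H w (i, j) \<in> verts H"
    using block_map_in[OF 1(1,2)] edge_list_nth[OF w_less[OF 1(2)]] edges_chain(3)[OF H] by blast
  then show ?thesis using 1 singleton_edge by simp
next
  case (2 j)
  then show ?thesis using block_map_image edge_list_nth w_less by simp
qed

lemma singleton_block_sal:
  assumes "i \<in> {1..r}" "j < length w" "k < length w"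
  shows "({(i, j)}, {1..r} \<times> {k}) \<in> sal_of (chain_box r (length w))"
  using assms r by (auto simp: sal_def chain_box_def boxtimes_def card_cartesian_product)

lemma singletons_sal:
  assumes "i \<in> {1..r}" "i' \<in> {1..r}" "j < k" "k < length w"
  shows "({(i, j)}, {(i', k)}) \<in> sal_of (chain_box r (length w))"
  using assms by (auto simp: sal_def chain_box_def boxtimes_def nat_less_def)

lemma blocks_sal:
  assumes "j < k" "k < length w"
  shows "({1..r} \<times> {j}, {1..r} \<times> {k}) \<in> sal_of (chain_box r (length w))"
proof -
  let ?K = "chain_box r (length w)"
  have V: "{1..r} \<times> {j} \<subseteq> verts ?K" "{1..r} \<times> {k} \<subseteq> verts ?K"
    using assms by (auto simp: chain_box_def boxtimes_def)
  have c: "finite_chain (verts ?K) (ord ?K)"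
    using chain_box_Ob by (auto simp: fin_ordered_refl_hypergraph_def)
  \<comment> \<open>The last vertex of block k is the largest in both blocks and so decides the
    comparison.\<close>
  have "(r, k) \<in> {1..r} \<times> {k} - {1..r} \<times> {j}" using assms r by auto
  moreover have "\<forall>z\<in>verts ?K. ((r, k), z) \<in> ord ?K \<longrightarrow> (z \<in> {1..r} \<times> {j} \<longleftrightarrow> z \<in> {1..r} \<times> {k})"
    using assms by (auto simp: chain_box_def boxtimes_def nat_less_def)
  ultimately have "({1..r} \<times> {j}, {1..r} \<times> {k}) \<in> alex (verts ?K) (ord ?K)"
    using alex_iff[OF c V] by blast
  then show ?thesis using r V by (auto simp: sal_def card_cartesian_product)
qed

text \<open>If \<open>b\<close> is a block, the word provides an earlier block over
  \<open>X\<close>. If \<open>b\<close> is a vertex, \<open>Y\<close> is a loop and hence so is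
  \<open>X\<close>; an earlier block over a loop is sent there vertex by vertex, so one of its
  vertices serves.\<close>

lemma block_map_rigid:
  "rigid_surjection (edges (chain_box r (length w))) (sal_of (chain_box r (length w)))
     (edges H) (sal_of H) (\<lambda>e. block_map r H w ` e)"
proof -
  let ?K = "chain_box r (length w)" and ?f = "block_map r H w"
  interpret K: ordered_hypergraph r ?K by unfold_locales (use r chain_box_Ob in auto)
  show ?thesis
  proof (rule rigid_surjectionI)
    show "finite (edges ?K)" "trans (sal_of ?K)" "irrefl (sal_of ?K)" "total_on (edges ?K) (sal_of ?K)"
      using K.sal by auto
    show "(\<lambda>e. ?f ` e) ` edges ?K = edges H"
    proof (intro subset_antisym subsetI)
      fix e assume "e \<in> edges H"
      then obtain q where q: "q < card (edges H)" "edge_list H ! q = e" by (rule edge_index)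
      then have "q \<in> set w" using w by (auto simp: param_word_iff)
      then obtain j where "j < length w" "w ! j = q" by (auto simp: in_set_conv_nth)
      then show "e \<in> (\<lambda>e. ?f ` e) ` edges ?K"
        using q block_map_image box_edges(2) by (metis image_eqI)
    qed (use block_map_edge in auto)
  next
    fix X Y b assume XY: "X \<in> edges H" "Y \<in> edges H" "(X, Y) \<in> sal_of H" and b: "b \<in> edges ?K" "?f ` b = Y"
    obtain x where x: "x < card (edges H)" "edge_list H ! x = X" using XY(1) by (rule edge_index)
    obtain y where y: "y < card (edges H)" "edge_list H ! y = Y" using XY(2) by (rule edge_index)
    have xy: "x < y" using edge_list_less_iff[OF x(1) y(1)] x y XY by simp
    have one: "?f ` {(1, j)} = X" if "card X = 1" "j < length w" "w ! j = x" for j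
      using block_map_in[of 1 j] that r x by (auto simp: card_1_singleton_iff)
    from b(1) show "\<exists>a\<in>edges ?K. ?f ` a = X \<and> (a, b) \<in> sal_of ?K"
    proof (cases rule: box_edge_cases)
      case (1 i k)
      then obtain v where v: "Y = {v}" "v \<in> edge_list H ! (w ! k)"
        using b(2) block_map_in by auto
      have wk: "w ! k < card (edges H)" using w_less 1 by simp
      have "X \<noteq> {}" using XY(1) r by (cases rule: edge_cases) auto
      then have cX: "card X = 1" using XY(3) v(1) by (auto simp: sal_def)
      \<comment> \<open>A vertex of block k only reveals that its image lies in edge number
        \<open>w ! k\<close>. That edge is the loop \<open>Y\<close> itself or a larger edge, which
        comes after all loops.\<close>
      have "y \<le> w ! k"
      proof (cases rule: edge_cases[OF edge_list_nth[OF wk]])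
        case (1 u)
        then have "edge_list H ! (w ! k) = edge_list H ! y" using v y by auto
        then show ?thesis using edge_list(3,4) wk y(1) by (simp add: nth_eq_iff_index_eq)
      next
        case 2
        then have "(Y, edge_list H ! (w ! k)) \<in> sal_of H" using v by (auto simp: sal_def)
        then show ?thesis using edge_list_less_iff[OF y(1) wk] y(2) by simp
      qed
      then obtain j where j: "j < k" "w ! j = x"
        using param_word_0_earlier[OF w, of k x] 1 xy by auto
      then have "({(1, j)}, b) \<in> sal_of ?K" using singletons_sal[of 1 i j k] 1 r by simp
      then show ?thesis using one[OF cX, of j] j 1 r box_edges(1)[of 1 j] by force
    next
      case (2 k)
      have wk: "w ! k < card (edges H)" using w_less 2 by simp
      have "edge_list H ! (w ! k) = edge_list H ! y" using block_map_image 2 b(2) y(2) by simp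
      then have "w ! k = y" using edge_list(3,4) wk y(1) by (simp add: nth_eq_iff_index_eq)
      then obtain j where j: "j < k" "w ! j = x"
        using param_word_0_earlier[OF w, of k x] 2 xy by auto
      show ?thesis
      proof (cases "card X = 1")
        case True
        have "({(1, j)}, b) \<in> sal_of ?K" using singleton_block_sal[of 1 j k] 2 r j by simp
        then show ?thesis using one[OF True, of j] j 2 r box_edges(1)[of 1 j] by force
      next
        case False
        have "({1..r} \<times> {j}, b) \<in> sal_of ?K" using blocks_sal[of j k] 2 j by simp
        moreover have "?f ` ({1..r} \<times> {j}) = X" using block_map_image[of j] j 2 x by simp
        ultimately show ?thesis using box_edges(2)[of j] j 2 by force
      qed
    qed
  qed
qed

lemma block_map_srq: "block_map r H w \<in> srq_homs (chain_box r (length w)) H"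
proof -
  let ?K = "chain_box r (length w)" and ?f = "block_map r H w"
  have V: "verts ?K = {1..r} \<times> {..<length w}" by (simp add: chain_box_def boxtimes_def)
  have "?f p \<in> verts H" if "p \<in> verts ?K" for p
  proof -
    obtain i j where "p = (i, j)" by (cases p)
    then have p: "p = (i, j)" "i \<in> {1..r}" "j < length w" using that unfolding V by simp_all
    then show ?thesis
      using block_map_in[of i j] edge_list_nth[OF w_less[of j]] edges_chain(3)[OF H] by blast
  qed
  moreover have "?f \<in> extensional (verts ?K)" unfolding V by (simp add: block_map_def)
  moreover have "(?f x, ?f y) \<in> ord H"
    if b: "b \<in> edges ?K" "\<not> (\<exists>c. \<forall>x\<in>b. ?f x = c)" "x \<in> b" "y \<in> b" "(x, y) \<in> ord ?K" for b x y
    using b(1)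
  proof (cases rule: box_edge_cases)
    case (1 i j)
    then show ?thesis using b(2) by auto
  next
    case (2 j)
    define e where "e = edge_list H ! (w ! j)"
    have e: "e \<in> edges H" unfolding e_def using edge_list_nth w_less 2 by simp
    obtain i i' where ii: "x = (i, j)" "y = (i', j)" "i \<in> {1..r}" "i' \<in> {1..r}" "i < i'"
      using b 2 by (auto simp: chain_box_def boxtimes_def nat_less_def)
    have "?f ` b = e" using block_map_image[OF 2(1)] 2 e_def by simp
    then have "card e \<noteq> 1" using b(2) by (auto simp: card_1_singleton_iff)
    then have t: "edge_tuple r H e = chain_enum (ord H) e" by (simp add: edge_tuple_def)
    have "(chain_enum (ord H) e ! (i - 1), chain_enum (ord H) e ! (i' - 1)) \<in> ord H"
      using sorted_wrt_nth_less[OF edge_enum(2)[OF e], of "i - 1" "i' - 1"] edge_tuple(2)[OF e] ii t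
      by auto
    then show ?thesis using ii 2 t e_def by (simp add: block_map_def)
  qed
  ultimately show ?thesis
    using block_map_rigid block_map_edge
    unfolding srq_homs_def strong_rigid_quotient_map_def hypergraph_hom_def by (auto simp: PiE_iff)
qed

end

end

subsection \<open>Quotient maps as words\<close>

definition edge_word :: "'a ohgr \<Rightarrow> 'b ohgr \<Rightarrow> ('b \<Rightarrow> 'a) \<Rightarrow> nat list" where
  "edge_word A B f = map (\<lambda>e. THE q. q < card (edges A) \<and> edge_list A ! q = f ` e) (edge_list B)"

locale srq_map = A: ordered_hypergraph r A + B: ordered_hypergraph r B
  for r and A :: "'a ohgr" and B :: "'b ohgr" +
  fixes f :: "'b \<Rightarrow> 'a" assumes f: "f \<in> srq_homs B A"
begin

lemma rigid: "rigid_surjection (edges B) (sal_of B) (edges A) (sal_of A) (\<lambda>e. f ` e)"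
  using f by (simp add: srq_homs_def strong_rigid_quotient_map_def)

lemma image_edges: "(\<lambda>e. f ` e) ` edges B = edges A"
  using rigid by (simp add: rigid_surjection_def)

lemma length_edge_word: "length (edge_word A B f) = card (edges B)"
  by (simp add: edge_word_def B.edge_list(4))

lemma edge_word_nth:
  assumes "q < card (edges B)"
  shows "edge_word A B f ! q < card (edges A)" "edge_list A ! (edge_word A B f ! q) = f ` (edge_list B ! q)"
proof -
  have "f ` (edge_list B ! q) \<in> edges A" using B.edge_list_nth[OF assms] image_edges by auto
  then have "\<exists>!p. p < card (edges A) \<and> edge_list A ! p = f ` (edge_list B ! q)"
    using A.edge_index A.edge_list(3,4) by (metis nth_eq_iff_index_eq)
  from theI'[OF this]
  show "edge_word A B f ! q < card (edges A)" "edge_list A ! (edge_word A B f ! q) = f ` (edge_list B ! q)"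
    using assms by (auto simp: edge_word_def B.edge_list(4))
qed

text \<open>Rigidity on edges is the first-occurrence condition of \<open>param_word_iff\<close>: an
  edge below the image of the j-th edge is the image of an earlier one.\<close>

lemma param_word_edge_word: "param_word 0 (card (edges A)) (edge_word A B f)"
  unfolding param_word_iff
proof (intro conjI allI impI subsetI)
  fix x assume "x \<in> set (edge_word A B f)"
  then show "x \<in> {..<0 + card (edges A)}"
    using edge_word_nth(1) length_edge_word by (auto simp: in_set_conv_nth)
next
  fix x assume "x \<in> {0..<0 + card (edges A)}"
  then have x: "x < card (edges A)" by simp
  then obtain e where e: "e \<in> edges B" "f ` e = edge_list A ! x"
    using A.edge_list_nth image_edges by (metis imageE)
  obtain q where q: "q < card (edges B)" "edge_list B ! q = e" using e(1) by (rule B.edge_index)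
  have "edge_word A B f ! q = x"
    using edge_word_nth[OF q(1)] q e x A.edge_list(3,4) by (simp add: nth_eq_iff_index_eq)
  then show "x \<in> set (edge_word A B f)" using q length_edge_word by (metis nth_mem)
next
  fix j x assume j: "j < length (edge_word A B f)" and "x \<in> {0..<edge_word A B f ! j}"
  then have x: "x < edge_word A B f ! j" by simp
  have j: "j < card (edges B)" using j length_edge_word by simp
  note wj = edge_word_nth[OF j]
  have xA: "x < card (edges A)" using x wj by simp
  have "(edge_list A ! x, f ` (edge_list B ! j)) \<in> sal_of A"
    using A.edge_list_less_iff[OF xA wj(1)] x wj(2) by simp
  then obtain e where e: "e \<in> edges B" "f ` e = edge_list A ! x" "(e, edge_list B ! j) \<in> sal_of B"
    using rigid_surjection_earlier[OF B.sal(4,1,2,3) rigid A.edge_list_nth[OF xA] _ B.edge_list_nth[OF j]] by auto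
  obtain q where q: "q < card (edges B)" "edge_list B ! q = e" using e(1) by (rule B.edge_index)
  have "q < j" using B.edge_list_less_iff[OF q(1) j] q e by simp
  moreover have "edge_word A B f ! q = x"
    using edge_word_nth[OF q(1)] q e xA A.edge_list(3,4) by (simp add: nth_eq_iff_index_eq)
  ultimately show "x \<in> set (take j (edge_word A B f))"
    using j length_edge_word by (auto simp: in_set_conv_nth)
qed

text \<open>On an edge \<open>f\<close> is constant, giving a constant tuple, or increasing by the
  order condition, and then it carries the increasing enumeration to that of the image.\<close>

lemma edge_tuple_image:
  assumes e: "e \<in> edges B"
  shows "edge_tuple r A (f ` e) = map f (edge_tuple r B e)"
proof (cases "\<exists>c. \<forall>x\<in>e. f x = c")
  case True
  then obtain c where c: "\<forall>x\<in>e. f x = c" by blast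
  have "e \<noteq> {}" using e B.r by (cases rule: B.edge_cases) auto
  then have "f ` e = {c}" using c by auto
  moreover have "map f (edge_tuple r B e) = replicate r c"
    using B.edge_tuple[OF e] c by (intro replicate_eqI) auto
  ultimately show ?thesis by (simp add: edge_tuple_def)
next
  case False
  then have 1: "card e \<noteq> 1" "card (f ` e) \<noteq> 1" by (auto simp: card_1_singleton_iff)
  have mono: "(f x, f y) \<in> ord A" if "x \<in> e" "y \<in> e" "(x, y) \<in> ord B" for x y
    using f e False that unfolding srq_homs_def strong_rigid_quotient_map_def by blast
  have fe: "f ` e \<in> edges A" using e image_edges by auto
  have "sorted_wrt (\<lambda>x y. (x, y) \<in> ord A) (map f (chain_enum (ord B) e))"
    unfolding sorted_wrt_map
    by (rule sorted_wrt_mono_rel[OF _ B.edge_enum(2)[OF e]]) (use mono B.edge_enum(1)[OF e] in auto)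
  then have "chain_enum (ord A) (f ` e) = map f (chain_enum (ord B) e)"
    using A.edge_enum[OF fe] B.edge_enum[OF e] by (intro sorted_wrt_unique[OF A.ord(1,2)]) auto
  then show ?thesis using 1 by (simp add: edge_tuple_def)
qed

text \<open>Since tuples go to tuples, composing with \<open>f\<close> only renumbers the edges
  assigned to the blocks. This carries the statement on words over to maps.\<close>

lemma compose_block_map:
  assumes w: "param_word 0 (card (edges B)) w"
  shows "compose (verts (chain_box r (length w))) f (block_map r B w)
    = block_map r A (map ((!) (edge_word A B f)) w)"
proof
  fix p
  have V: "verts (chain_box r (length w)) = {1..r} \<times> {..<length w}" by (simp add: chain_box_def boxtimes_def)
  show "compose (verts (chain_box r (length w))) f (block_map r B w) p
    = block_map r A (map ((!) (edge_word A B f)) w) p"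
  proof (cases "p \<in> {1..r} \<times> {..<length w}")
    case True
    then obtain i j where p: "p = (i, j)" "i \<in> {1..r}" "j < length w" by auto
    have wj: "w ! j < card (edges B)" using B.w_less[OF w p(3)] .
    note t = edge_tuple_image[OF B.edge_list_nth[OF wj]] B.edge_tuple(2)[OF B.edge_list_nth[OF wj]]
    show ?thesis using p t edge_word_nth(2)[OF wj] by (auto simp: compose_def V block_map_def)
  next
    case False
    then show ?thesis by (auto simp: compose_def V block_map_def)
  qed
qed

end

text \<open>Maps from the box are pulled back along \<open>u\<close>, so any \<open>D\<close> with a
  map to the box will do, in particular a copy of it with vertices of another type.\<close>

lemma srq_dual_ramsey:
  fixes A :: "'a ohgr" and B :: "'b ohgr"
  assumes r: "r \<ge> 2" and A: "fin_ordered_refl_hypergraph r A" and B: "fin_ordered_refl_hypergraph r B"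
    and "verts B \<noteq> {}" "srq_homs B A \<noteq> {}"
  shows "\<exists>n>0. \<forall>(D :: 'd ohgr) u. fin_ordered_refl_hypergraph r D \<longrightarrow> u \<in> srq_homs D (chain_box r n) \<longrightarrow>
    (\<forall>\<chi> \<in> srq_homs D A \<rightarrow> {1..k::nat}. \<exists>w\<in>srq_homs D B. \<exists>c. \<forall>f\<in>srq_homs B A.
       \<chi> (compose (verts D) f w) = c)"
proof -
  interpret A: ordered_hypergraph r A by unfold_locales (use r A in auto)
  interpret B: ordered_hypergraph r B by unfold_locales (use r B in auto)
  have two: "srq_map r A B f" if "f \<in> srq_homs B A" for f
    by unfold_locales (use that in auto)
  obtain v where v: "v \<in> verts B" using assms by blast
  then have eB: "edges B \<noteq> {}" using B.singleton_edge by auto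
  obtain f where "f \<in> srq_homs B A" using assms by blast
  then have "edges A \<noteq> {}" using eB srq_map.image_edges[OF two] by blast
  then have pos: "card (edges A) > 0" "card (edges B) > 0" using eB A.sal(4) B.sal(4) by (auto simp: card_gt_0_iff)
  obtain n where n: "n > 0" and ram: "\<And>\<chi> :: nat list \<Rightarrow> nat. \<forall>g. \<chi> g < Suc k \<Longrightarrow>
    \<exists>w. param_word 0 (card (edges B)) w \<and> length w = n \<and>
      (\<exists>c. \<forall>g. param_word 0 (card (edges A)) g \<longrightarrow> length g = card (edges B) \<longrightarrow> \<chi> (map ((!) g) w) = c)"
    using dual_ramsey_words[OF pos, of "Suc k"] by blast
  show ?thesis
  proof (intro exI[of _ n] conjI allI impI ballI n)
    fix D :: "'d ohgr" and u \<chi>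
    assume D: "fin_ordered_refl_hypergraph r D" and u: "u \<in> srq_homs D (chain_box r n)"
      and \<chi>: "\<chi> \<in> srq_homs D A \<rightarrow> {1..k}"
    \<comment> \<open>Words that encode no map get the colour 0, which lies outside
      \<open>{1..k}\<close>; this gives \<open>Suc k\<close> colours.\<close>
    define \<chi>' where "\<chi>' g = (if param_word 0 (card (edges A)) g \<and> length g = n
      then \<chi> (compose (verts D) (block_map r A g) u) else 0)" for g
    have "compose (verts D) (block_map r A g) u \<in> srq_homs D A"
      if "param_word 0 (card (edges A)) g" "length g = n" for g
      by (rule srq_comp[OF D chain_box_Ob u]) (use A.block_map_srq[OF that(1)] that in simp)
    then have "\<forall>g. \<chi>' g < Suc k" using \<chi> by (force simp: \<chi>'_def less_Suc_eq_le)
    then obtain w c where w: "param_word 0 (card (edges B)) w" "length w = n"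
      and c: "\<And>g. param_word 0 (card (edges A)) g \<Longrightarrow> length g = card (edges B) \<Longrightarrow> \<chi>' (map ((!) g) w) = c"
      using ram by blast
    show "\<exists>w\<in>srq_homs D B. \<exists>c. \<forall>f\<in>srq_homs B A. \<chi> (compose (verts D) f w) = c"
    proof (intro bexI[of _ "compose (verts D) (block_map r B w) u"] exI[of _ c] ballI)
      show "compose (verts D) (block_map r B w) u \<in> srq_homs D B"
        by (rule srq_comp[OF D chain_box_Ob u]) (use B.block_map_srq[OF w(1)] w in simp)
      fix f assume "f \<in> srq_homs B A"
      then interpret srq_map r A B f by (rule two)
      let ?g = "edge_word A B f"
      have rg: "param_word 0 (card (edges A)) (map ((!) ?g) w)"
      proof -
        have "param_subst [] ?g w = map ((!) ?g) w"
          using subst_eq_map[of "[]" "card (edges B)" w ?g] w length_edge_word by simp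
        then show ?thesis
          using param_word_subst[OF w(1) param_word_edge_word, of "[]"] length_edge_word by simp
      qed
      have "compose (verts D) f (compose (verts D) (block_map r B w) u)
          = compose (verts D) (compose (verts (chain_box r n)) f (block_map r B w)) u"
        by (rule compose_assoc) (use u in \<open>auto simp: srq_homs_def\<close>)
      also have "\<dots> = compose (verts D) (block_map r A (map ((!) ?g) w)) u"
        using compose_block_map[OF w(1)] w(2) by simp
      finally show "\<chi> (compose (verts D) f (compose (verts D) (block_map r B w) u)) = c"
        using c[OF param_word_edge_word length_edge_word] rg w(2) by (simp add: \<chi>'_def)
    qed
  qed
qed

subsection \<open>Isomorphic copies and bipartite graphs\<close>

text \<open>By \<open>alex_iff\<close> a comparison of large sets rests on a single witness, and
  \<open>f\<close> carries this witness over.\<close>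

lemma sal_image:
  assumes c: "finite_chain V lt" "finite_chain V' lt'" and inj: "inj_on f V" and V': "f ` V = V'"
    and mono: "\<And>x y. x \<in> V \<Longrightarrow> y \<in> V \<Longrightarrow> (x, y) \<in> lt \<longleftrightarrow> (f x, f y) \<in> lt'"
    and XY: "(X, Y) \<in> sal V lt"
  shows "(f ` X, f ` Y) \<in> sal V' lt'"
proof -
  have S: "X \<subseteq> V" "Y \<subseteq> V" using XY by (auto simp: sal_def)
  have card: "card (f ` Z) = card Z" if "Z \<subseteq> V" for Z
    using inj that by (meson card_image inj_on_subset)
  have S': "f ` X \<subseteq> V'" "f ` Y \<subseteq> V'" using S V' by auto
  have mem: "f z \<in> f ` Z \<longleftrightarrow> z \<in> Z" if "z \<in> V" "Z \<subseteq> V" for z Z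
    using inj that by (meson inj_on_image_mem_iff)
  have al: "(f ` X, f ` Y) \<in> alex V' lt'" if al: "(X, Y) \<in> alex V lt"
  proof -
    obtain m where m: "m \<in> Y - X" "\<And>z. z \<in> V \<Longrightarrow> (m, z) \<in> lt \<Longrightarrow> (z \<in> X \<longleftrightarrow> z \<in> Y)"
      using al alex_iff[OF c(1) S] by blast
    have "f m \<in> f ` Y - f ` X" using m(1) S mem by blast
    moreover have "\<forall>z\<in>V'. (f m, z) \<in> lt' \<longrightarrow> (z \<in> f ` X \<longleftrightarrow> z \<in> f ` Y)"
    proof (intro ballI impI)
      fix z assume z: "z \<in> V'" "(f m, z) \<in> lt'"
      then obtain y where y: "y \<in> V" "z = f y" using V' by auto
      then have "(m, y) \<in> lt" using mono[of m y] z m(1) S by auto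
      then show "z \<in> f ` X \<longleftrightarrow> z \<in> f ` Y" using m(2) y mem S by simp
    qed
    ultimately show ?thesis using alex_iff[OF c(2) S'] by blast
  qed
  consider "X = {}" "Y \<noteq> {}" | x y where "X = {x}" "Y = {y}" "(x, y) \<in> lt"
    | "card X = 1" "card Y > 1" | "card X > 1" "card Y > 1" "(X, Y) \<in> alex V lt"
    using XY by (auto simp: sal_def)
  then show ?thesis
  proof cases
    case 2
    then have "(f x, f y) \<in> lt'" using mono S by simp
    then show ?thesis using 2 S' by (auto simp: sal_def)
  qed (use S' card S al in \<open>auto simp: sal_def\<close>)
qed

lemma isomorphism_srq:
  assumes r: "r \<ge> 2" and H: "fin_ordered_refl_hypergraph r H" and K: "fin_ordered_refl_hypergraph r K"
    and f: "f \<in> verts H \<rightarrow>\<^sub>E verts K" and bij: "bij_betw f (verts H) (verts K)"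
    and mono: "\<And>x y. x \<in> verts H \<Longrightarrow> y \<in> verts H \<Longrightarrow> (x, y) \<in> ord H \<longleftrightarrow> (f x, f y) \<in> ord K"
    and edges: "(\<lambda>e. f ` e) ` edges H = edges K"
  shows "f \<in> srq_homs H K"
proof -
  interpret H: ordered_hypergraph r H by unfold_locales (use r H in auto)
  interpret K: ordered_hypergraph r K by unfold_locales (use r K in auto)
  have V: "e \<subseteq> verts H" if "e \<in> edges H" for e using that edges_chain(3)[OF H] by auto
  have inj: "inj_on f (verts H)" "f ` verts H = verts K" using bij by (auto simp: bij_betw_def)
  have sal: "(f ` a, f ` b) \<in> sal_of K" if "(a, b) \<in> sal_of H" for a b
    by (rule sal_image[OF H.ord(6) K.ord(6) inj mono that])
  have "rigid_surjection (edges H) (sal_of H) (edges K) (sal_of K) (\<lambda>e. f ` e)"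
  proof (rule rigid_surjectionI)
    show "finite (edges H)" "trans (sal_of H)" "irrefl (sal_of H)" "total_on (edges H) (sal_of H)"
      using H.sal by auto
    show "(\<lambda>e. f ` e) ` edges H = edges K" by (rule edges)
  next
    fix X Y b assume XY: "X \<in> edges K" "Y \<in> edges K" "(X, Y) \<in> sal_of K" and b: "b \<in> edges H" "f ` b = Y"
    obtain a where a: "a \<in> edges H" "f ` a = X"
      using XY(1) unfolding edges[symmetric] by auto
    \<comment> \<open>One direction of monotonicity suffices, since \<open>sal\<close> is total:
      were \<open>b\<close> below \<open>a\<close>, their images would compare the wrong
      way.\<close>
    have asym: "(Y, X) \<notin> sal_of K" using XY(3) K.sal(1,2) by (metis irreflD transD)
    have "X \<noteq> Y" using XY(3) K.sal(2) by (metis irreflD)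
    then have "(a, b) \<in> sal_of H" using a b asym sal H.sal(3) unfolding total_on_def by metis
    then show "\<exists>a\<in>edges H. f ` a = X \<and> (a, b) \<in> sal_of H" using a by blast
  qed
  moreover have "hypergraph_hom H K f" using f edges by (auto simp: hypergraph_hom_def)
  moreover have "\<forall>e\<in>edges H. \<not> (\<exists>c. \<forall>x\<in>e. f x = c) \<longrightarrow>
        (\<forall>x\<in>e. \<forall>y\<in>e. (x, y) \<in> ord H \<longrightarrow> (f x, f y) \<in> ord K)" using mono V by blast
  ultimately show ?thesis using f unfolding srq_homs_def strong_rigid_quotient_map_def by blast
qed

text \<open>Moves boxes, whose vertices are pairs, into the vertex type of the category.\<close>

definition rename :: "('b \<Rightarrow> 'a) \<Rightarrow> 'b ohgr \<Rightarrow> 'a ohgr" where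
  "rename f K = \<lparr>verts = f ` verts K, edges = (\<lambda>e. f ` e) ` edges K, ord = map_prod f f ` ord K\<rparr>"

lemma nsets_image_inj: "inj f \<Longrightarrow> (\<lambda>e. f ` e) ` [V]\<^bsup>n\<^esup> = [f ` V]\<^bsup>n\<^esup>"
proof (intro subset_antisym subsetI)
  fix e assume f: "inj f" and "e \<in> [f ` V]\<^bsup>n\<^esup>"
  then have e: "e \<subseteq> f ` V" "finite e" "card e = n" by (auto simp: nsets_def)
  then obtain d where d: "d \<subseteq> V" "e = f ` d" by (metis subset_imageE)
  have "inj_on f d" using f by (meson inj_on_subset subset_UNIV)
  then have "d \<in> [V]\<^bsup>n\<^esup>" using d e by (auto simp: nsets_def card_image finite_image_iff)
  then show "e \<in> (\<lambda>e. f ` e) ` [V]\<^bsup>n\<^esup>" using d by blast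
next
  fix e assume f: "inj f" and "e \<in> (\<lambda>e. f ` e) ` [V]\<^bsup>n\<^esup>"
  then obtain d where d: "e = f ` d" "d \<in> [V]\<^bsup>n\<^esup>" by blast
  have "inj_on f d" using f by (meson inj_on_subset subset_UNIV)
  then show "e \<in> [f ` V]\<^bsup>n\<^esup>" using d by (auto simp: nsets_def card_image)
qed

lemma rename_Ob:
  assumes f: "inj f" and K: "fin_ordered_refl_hypergraph r K"
  shows "fin_ordered_refl_hypergraph r (rename f K)"
proof -
  have c: "finite (verts K)" "ord K \<subseteq> verts K \<times> verts K" "trans (ord K)" "irrefl (ord K)" "total_on (verts K) (ord K)"
    using K by (auto simp: fin_ordered_refl_hypergraph_def finite_chain_def strict_linear_order_on_def)
  obtain S where S: "S \<subseteq> [verts K]\<^bsup>r\<^esup>" "edges K = [verts K]\<^bsup>1\<^esup> \<union> S"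
    using K by (auto simp: fin_ordered_refl_hypergraph_def)
  have iff: "(f x, f y) \<in> map_prod f f ` ord K \<longleftrightarrow> (x, y) \<in> ord K" for x y
    using inj_image_mem_iff[OF prod.inj_map[OF f f], of "(x, y)" "ord K"] by simp
  have ran: "\<exists>x\<in>verts K. \<exists>y\<in>verts K. u = f x \<and> v = f y" if "(u, v) \<in> map_prod f f ` ord K" for u v
    using that c(2) by auto
  have "trans (map_prod f f ` ord K)"
    using ran iff c(3) by (intro transI) (metis injD[OF f] transD)
  moreover have "irrefl (map_prod f f ` ord K)" using ran iff c(4) unfolding irrefl_def by (metis injD[OF f])
  moreover have "total_on (f ` verts K) (map_prod f f ` ord K)" using iff c(5) by (auto simp: total_on_def)
  moreover have "map_prod f f ` ord K \<subseteq> f ` verts K \<times> f ` verts K" using ran by blast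
  ultimately have "finite_chain (verts (rename f K)) (ord (rename f K))"
    using c(1) by (auto simp: finite_chain_def strict_linear_order_on_def rename_def)
  moreover have "(\<lambda>e. f ` e) ` S \<subseteq> [verts (rename f K)]\<^bsup>r\<^esup>"
    using S(1) nsets_image_inj[OF f, of "verts K" r] by (auto simp: rename_def)
  moreover have "edges (rename f K) = [verts (rename f K)]\<^bsup>1\<^esup> \<union> (\<lambda>e. f ` e) ` S"
    using S(2) nsets_image_inj[OF f, of "verts K" 1] by (simp add: rename_def image_Un)
  ultimately show ?thesis unfolding fin_ordered_refl_hypergraph_def by blast
qed

lemma rename_isomorphic:
  assumes r: "r \<ge> 2" and f: "inj f" and K: "fin_ordered_refl_hypergraph r K"
  shows "isomorphic_srq (rename f K) K"
proof -
  let ?H = "rename f K" and ?g = "restrict (inv f) (f ` verts K)" and ?f = "restrict f (verts K)"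
  note H = rename_Ob[OF f K]
  have V: "e \<subseteq> verts K" if "e \<in> edges K" for e using that edges_chain(3)[OF K] by auto
  have gf: "inv f (f x) = x" for x using f by simp
  have iff: "(f x, f y) \<in> ord ?H \<longleftrightarrow> (x, y) \<in> ord K" for x y
    using inj_image_mem_iff[OF prod.inj_map[OF f f], of "(x, y)" "ord K"] by (simp add: rename_def)
  have fe: "?f ` e = f ` e" if "e \<in> edges K" for e using V[OF that] by (intro image_cong) auto
  have ge: "?g ` f ` e = e" if "e \<in> edges K" for e
  proof -
    have "(\<lambda>x. ?g (f x)) ` e = (\<lambda>x. x) ` e"
      using V[OF that] gf by (intro image_cong) auto
    then show ?thesis by (simp only: image_image image_ident)
  qed
  have f1: "?f \<in> srq_homs K ?H"
  proof (rule isomorphism_srq[OF r K H])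
    show "bij_betw ?f (verts K) (verts ?H)"
      using f by (auto simp: bij_betw_def rename_def inj_on_def inj_def)
    show "(\<lambda>e. ?f ` e) ` edges K = edges ?H" unfolding rename_def using fe by simp
  qed (auto simp: iff, auto simp: rename_def)
  have g1: "?g \<in> srq_homs ?H K"
  proof (rule isomorphism_srq[OF r H K])
    show "bij_betw ?g (verts ?H) (verts K)"
      by (rule bij_betw_byWitness[of _ f]) (auto simp: rename_def gf)
    have "(\<lambda>e. ?g ` e) ` edges ?H = (\<lambda>e. ?g ` f ` e) ` edges K"
      by (simp only: rename_def ohgr.simps image_image)
    also have "\<dots> = (\<lambda>e. e) ` edges K" by (rule image_cong[OF refl ge])
    finally show "(\<lambda>e. ?g ` e) ` edges ?H = edges K" by simp
    show "?g \<in> verts ?H \<rightarrow>\<^sub>E verts K" by (auto simp: rename_def gf)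
    fix x y assume "x \<in> verts ?H" "y \<in> verts ?H"
    then obtain a b where "x = f a" "y = f b" "a \<in> verts K" "b \<in> verts K" by (auto simp: rename_def)
    then show "(x, y) \<in> ord ?H \<longleftrightarrow> (?g x, ?g y) \<in> ord K" by (simp add: iff gf)
  qed
  have "compose (verts ?H) ?f ?g = restrict id (verts ?H)"
    by (rule ext) (auto simp: compose_def rename_def gf)
  moreover have "compose (verts K) ?g ?f = restrict id (verts K)"
    by (rule ext) (auto simp: compose_def gf)
  ultimately show ?thesis using f1 g1 unfolding isomorphic_srq_def by blast
qed

text \<open>The non-loop edges form a matching between the vertices with first coordinate 1 and
  those with first coordinate 2.\<close>

lemma bipartite_rename_boxtimes:
  assumes f: "inj f"
  shows "bipartite (rename f (boxtimes 2 L lt))"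
  unfolding bipartite_def
proof (intro exI conjI allI impI)
  let ?P = "f ` ({1} \<times> L)" and ?Q = "f ` ({2} \<times> L)"
  have 12: "{1..2} = {1, 2::nat}" by auto
  show "?P \<union> ?Q = verts (rename f (boxtimes 2 L lt))"
    unfolding rename_def boxtimes_def 12 by auto
  show "?P \<inter> ?Q = {}" using f by (auto dest: injD)
  fix x y assume xy: "{x, y} \<in> edges (rename f (boxtimes 2 L lt)) \<and> x \<noteq> y"
  then obtain e where e: "{x, y} = f ` e" "e \<in> edges (boxtimes 2 L lt)" by (auto simp: rename_def)
  consider p where "e = {p}" | l where "l \<in> L" "e = {1, 2} \<times> {l}"
    using e(2) unfolding boxtimes_def 12 by (auto simp: nsets_def card_1_singleton_iff)
  then show "x \<in> ?P \<and> y \<in> ?Q \<or> x \<in> ?Q \<and> y \<in> ?P"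
  proof cases
    case 1
    then show ?thesis using e xy by auto
  next
    case 2
    then have "{x, y} = {f (1, l), f (2, l)}" using e by auto
    then show ?thesis using 2(1) by (auto simp: doubleton_eq_iff)
  qed
qed

text \<open>Among three vertices of a clique, two would lie in the same part.\<close>

lemma bipartite_clique_free:
  assumes "bipartite G" "n \<ge> 3"
  shows "clique_free n G"
  unfolding clique_free_def
proof
  assume "\<exists>K\<in>[verts G]\<^bsup>n\<^esup>. [K]\<^bsup>2\<^esup> \<subseteq> edges G"
  then obtain K where K: "K \<subseteq> verts G" "card K = n" "[K]\<^bsup>2\<^esup> \<subseteq> edges G" by (auto simp: nsets_def)
  then obtain T where "T \<subseteq> K" "card T = 3" by (metis assms(2) obtain_subset_with_card_n)
  then obtain x y z where T: "{x, y, z} \<subseteq> K" "x \<noteq> y" "y \<noteq> z" "x \<noteq> z"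
    by (auto simp: card_3_iff)
  have ed: "{u, v} \<in> edges G" if "u \<in> K" "v \<in> K" "u \<noteq> v" for u v
    using that K(3) by (auto simp: nsets_def)
  obtain P Q where "P \<inter> Q = {}"
    "\<And>u v. {u, v} \<in> edges G \<Longrightarrow> u \<noteq> v \<Longrightarrow> u \<in> P \<and> v \<in> Q \<or> u \<in> Q \<and> v \<in> P"
    using assms(1) unfolding bipartite_def by metis
  then show False using T ed[of x y] ed[of y z] ed[of x z] by blast
qed

subsection \<open>The dual Ramsey property\<close>

lemma full_subcat_dual_ramsey:
  fixes Q :: "'a ohgr set"
  assumes r: "r \<ge> 2" and Q: "Q \<subseteq> Ob (OHgr_srq r)"
    and box: "\<And>(L :: nat set) lt. finite_chain L lt \<Longrightarrow> L \<noteq> {} \<Longrightarrow> \<exists>H\<in>Q. isomorphic_srq H (boxtimes r L lt)"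
  shows "dual_ramsey_property (full_subcat (OHgr_srq r) Q)"
proof -
  have simps [simp]: "Ob (full_subcat (OHgr_srq r) Q) = Q" "Hom (full_subcat (OHgr_srq r) Q) = srq_homs"
    "Comp (full_subcat (OHgr_srq r) Q) = (\<lambda>H H' H'' g f. compose (verts H) g f)"
    by (simp_all add: full_subcat_def OHgr_srq_def)
  have Ob: "fin_ordered_refl_hypergraph r H" if "H \<in> Q" for H
    using that Q by (auto simp: OHgr_srq_def)
  show ?thesis
    unfolding dual_ramsey_property_def simps
  proof (intro allI impI ballI)
    fix k :: nat and A B assume A: "A \<in> Q" and B: "B \<in> Q" and hom: "srq_homs B A \<noteq> {}"
    show "\<exists>D\<in>Q. \<forall>\<chi>\<in>srq_homs D A \<rightarrow> {1..k}. \<exists>w\<in>srq_homs D B. \<exists>c. \<forall>f\<in>srq_homs B A.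
        \<chi> (compose (verts D) f w) = c"
    proof (cases "verts B = {}")
      case True
      \<comment> \<open>On an empty vertex set all extensional maps coincide, so \<open>B\<close>
        itself serves as the object \<open>D\<close>. The case is separate because
        \<open>box\<close> provides copies for nonempty chains only.\<close>
      have "compose (verts B) f w = (\<lambda>_. undefined)" for f w :: "'a \<Rightarrow> 'a"
        using True by (auto simp: compose_def restrict_def)
      then show ?thesis using B srq_id[OF Ob[OF B]] by (intro bexI[of _ B]) auto
    next
      case False
      obtain n where n: "n > 0" and ram: "\<And>(D :: 'a ohgr) u. fin_ordered_refl_hypergraph r D \<Longrightarrow>
          u \<in> srq_homs D (chain_box r n) \<Longrightarrow>
          (\<forall>\<chi> \<in> srq_homs D A \<rightarrow> {1..k}. \<exists>w\<in>srq_homs D B. \<exists>c. \<forall>f\<in>srq_homs B A.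
            \<chi> (compose (verts D) f w) = c)"
        using srq_dual_ramsey[OF r Ob[OF A] Ob[OF B] False hom, where 'd = 'a and k = k] by blast
      obtain D where D: "D \<in> Q" "isomorphic_srq D (chain_box r n)"
        using box[OF nat_less_chain[of n]] n by (auto simp: chain_box_def)
      then obtain u where "u \<in> srq_homs D (chain_box r n)" by (auto simp: isomorphic_srq_def)
      then show ?thesis using ram[OF Ob[OF D(1)]] D(1) by blast
    qed
  qed
qed

lemma full_subcat_dual_ramsey_rename:
  fixes Q :: "'a ohgr set" and \<iota> :: "nat \<times> nat \<Rightarrow> 'a"
  assumes "r \<ge> 2" "Q \<subseteq> Ob (OHgr_srq r)" "inj \<iota>"
    and "\<And>(L :: nat set) lt. finite_chain L lt \<Longrightarrow> rename \<iota> (boxtimes r L lt) \<in> Q"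
  shows "dual_ramsey_property (full_subcat (OHgr_srq r) Q)"
proof (rule full_subcat_dual_ramsey[OF assms(1,2)])
  fix L :: "nat set" and lt assume L: "finite_chain L lt"
  have "fin_ordered_refl_hypergraph r (boxtimes r L lt)"
    using boxtimes_Ob[OF L] by (simp add: OHgr_srq_def)
  from rename_isomorphic[OF assms(1,3) this]
  show "\<exists>H\<in>Q. isomorphic_srq H (boxtimes r L lt)" using assms(4)[OF L] by blast
qed

theorem corollary5p8:
  assumes "infinite (UNIV :: 'a set)"
  shows
    "(\<forall>(r::nat) (Q :: 'a ohgr set).
        r \<ge> 2 \<and> Q \<subseteq> Ob (OHgr_srq r) \<and>
        (\<forall>(L :: nat set) lt. finite_chain L lt \<and> L \<noteq> {} \<longrightarrow>
           (\<exists>H\<in>Q. isomorphic_srq H (boxtimes r L lt)))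
        \<longrightarrow> dual_ramsey_property (full_subcat (OHgr_srq r) Q)) \<and>
     (\<forall>r::nat. r \<ge> 2 \<longrightarrow>
        dual_ramsey_property (OHgr_srq r :: ('a ohgr, 'a \<Rightarrow> 'a) cat)) \<and>
     dual_ramsey_property (OGra_srq :: ('a ohgr, 'a \<Rightarrow> 'a) cat) \<and>
     dual_ramsey_property
       (full_subcat OGra_srq {G \<in> Ob (OGra_srq :: ('a ohgr, 'a \<Rightarrow> 'a) cat). bipartite G}) \<and>
     (\<forall>n::nat. n \<ge> 3 \<longrightarrow>
        dual_ramsey_property
          (full_subcat OGra_srq {G \<in> Ob (OGra_srq :: ('a ohgr, 'a \<Rightarrow> 'a) cat). clique_free n G}))"
proof -
  \<comment> \<open>An infinite vertex type contains a copy of all pairs of naturals, and so has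
    room for every box over a chain of naturals.\<close>
  obtain g :: "nat \<Rightarrow> 'a" where "inj g" using infinite_countable_subset[OF assms] by blast
  then have inj: "inj (g \<circ> prod_encode)" by (intro inj_compose inj_prod_encode)
  have Ob: "rename (g \<circ> prod_encode) (boxtimes r L lt) \<in> Ob (OHgr_srq r)"
    if "finite_chain L lt" for r and L :: "nat set" and lt
    using rename_Ob[OF inj] boxtimes_Ob[OF that, of r] by (simp add: OHgr_srq_def)
  have all: "dual_ramsey_property (OHgr_srq r :: ('a ohgr, 'a \<Rightarrow> 'a) cat)" if "r \<ge> 2" for r
  proof -
    have "full_subcat (OHgr_srq r) (Ob (OHgr_srq r)) = (OHgr_srq r :: ('a ohgr, 'a \<Rightarrow> 'a) cat)"
      by (simp add: full_subcat_def)
    then show ?thesis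
      using full_subcat_dual_ramsey_rename[OF that order_refl inj Ob] by metis
  qed
  have bip: "bipartite (rename (g \<circ> prod_encode) (boxtimes 2 L lt))" for L :: "nat set" and lt
    by (rule bipartite_rename_boxtimes[OF inj])
  have clique: "clique_free n (rename (g \<circ> prod_encode) (boxtimes 2 L lt))"
    if "n \<ge> 3" for n and L :: "nat set" and lt
    using bipartite_clique_free[OF bip that] .
  show ?thesis
  proof (intro conjI allI impI)
    show "dual_ramsey_property (full_subcat (OHgr_srq r) Q)"
      if "r \<ge> 2 \<and> Q \<subseteq> Ob (OHgr_srq r) \<and>
        (\<forall>(L :: nat set) lt. finite_chain L lt \<and> L \<noteq> {} \<longrightarrow> (\<exists>H\<in>Q. isomorphic_srq H (boxtimes r L lt)))"
      for r and Q :: "'a ohgr set"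
      using that by (intro full_subcat_dual_ramsey) auto
    show "dual_ramsey_property
       (full_subcat OGra_srq {G \<in> Ob (OGra_srq :: ('a ohgr, 'a \<Rightarrow> 'a) cat). bipartite G})"
      by (rule full_subcat_dual_ramsey_rename[OF _ _ inj]) (use Ob bip in auto)
    show "dual_ramsey_property
        (full_subcat OGra_srq {G \<in> Ob (OGra_srq :: ('a ohgr, 'a \<Rightarrow> 'a) cat). clique_free n G})"
      if "n \<ge> 3" for n
      by (rule full_subcat_dual_ramsey_rename[OF _ _ inj])
        (use Ob clique[OF that] in auto)
  qed (use all in auto)
qed

end
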